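(* For $n\ge4$, the posets $\mathcal{FL}yn_n^w$ and $\mathcal{FL}yn_n^\bullet$ are not isomorphic. Consequently, $\Pi_n^w$ and $\Pi_n^\bullet$ each have multiple non-isomorphic Whitney duals.
   Context: Trees: a bicolored binary forest on $[n]$ is a forest of rooted planar binary trees (left child $L(v)$, right child $R(v)$) with leaves bijectively labeled by $[n]$ and internal vertices colored in $\{0,1\}$. $\nu(v)$ is the smallest leaf label below $v$; normalized means $\nu(v)=\nu(L(v))$ for all internal $v$; $v$ is Lyndon if $L(v)$ is a leaf or $\nu(R(L(v)))>\nu(R(v))$. A normalized tree is a pointed Lyndon tree if every internal $v$ with internal left child satisfies $\mathrm{color}(L(v))\ge\mathrm{color}(v)$ and, when both colors are $1$, $v$ is Lyndon; it is a bicolored Lyndon tree if every internal $v$ with internal left child is Lyndon or satisfies $\mathrm{color}(L(v))>\mathrm{color}(v)$. To $u$-merge two such trees $T_1,T_2$ (min leaf of $T_1$ smaller), create a new vertex $r$ of color $u$ with left child the root of $T_1$ and right child the root of $T_2$; while the result is not a tree of the required type, replace the subtree $r(x(X_L,X_R),Y)$ by $x(r(X_L,Y),X_R)$, colors kept. $\mathcal{FL}yn_n^\bullet$ (resp. $\mathcal{FL}yn_n^w$) is the set of forests on $[n]$ all of whose components are pointed (resp. bicolored) Lyndon trees, with $F\lessdot F'$ iff $F'$ arises from $F$ by $u$-merging exactly two trees, $u\in\{0,1\}$. $\Pi_n^\bullet$: pointed partitions of $[n]$ (collections of pointed sets $A^p$, $p\in A$, whose underlying sets partition $[n]$), with covers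 replacing two blocks $A^p,B^q$ by $(A\cup B)^p$ or $(A\cup B)^q$. $\Pi_n^w$: weighted partitions of $[n]$ (collections of $A^v$, $v\in\{0,\dots,|A|-1\}$, whose underlying sets partition $[n]$), with covers replacing $A^a,B^b$ by $(A\cup B)^{a+b+u}$, $u\in\{0,1\}$. Graded posets $P,Q$ with minima are Whitney duals if $|w_k(P)|=W_k(Q)$ and $|w_k(Q)|=W_k(P)$ for all $k$, where $w_k(P)=\sum_{\rho(x)=k}\mu(\hat0,x)$ and $W_k(P)=\#\{x:\rho(x)=k\}$. (The posets $\mathcal{FL}yn_n^\bullet$ and $\mathcal{FL}yn_n^w$ are Whitney duals of $\Pi_n^\bullet$; also $\Pi_n^\bullet$ and $\Pi_n^w$ have the same Whitney numbers of both kinds.) *)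

theory Defs
  imports Main "HOL-Library.Disjoint_Sets"
begin

section \<open>Graded posets and Whitney duals\<close>

text \<open>A poset is represented by its reflexive order relation \<open>r\<close>; its underlying set is
  \<open>Field r\<close>, and \<open>(x, y) \<in> r\<close> means \<open>x \<le> y\<close>.\<close>

definition poset_isomorphic :: "'a rel \<Rightarrow> 'b rel \<Rightarrow> bool" where
  "poset_isomorphic r s \<longleftrightarrow>
     (\<exists>f. bij_betw f (Field r) (Field s) \<and>
          (\<forall>x\<in>Field r. \<forall>y\<in>Field r. (x, y) \<in> r \<longleftrightarrow> (f x, f y) \<in> s))"

text \<open>The order on \<open>C\<close> generated by a step relation.\<close>

definition generated_order :: "'a set \<Rightarrow> ('a \<Rightarrow> 'a \<Rightarrow> bool) \<Rightarrow> 'a rel" where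
  "generated_order C step =
     {(x, y). x \<in> C \<and> y \<in> C \<and> (x, y) \<in> {(u, v). u \<in> C \<and> v \<in> C \<and> step u v}\<^sup>*}"

definition is_minimum :: "'a rel \<Rightarrow> 'a \<Rightarrow> bool" where
  "is_minimum r z \<longleftrightarrow> z \<in> Field r \<and> (\<forall>x\<in>Field r. (z, x) \<in> r)"

definition minimum :: "'a rel \<Rightarrow> 'a" where
  "minimum r = (THE z. is_minimum r z)"

definition maximal_chain :: "'a rel \<Rightarrow> 'a set \<Rightarrow> bool" where
  "maximal_chain r C \<longleftrightarrow> C \<in> Chains r \<and> (\<forall>D\<in>Chains r. C \<subseteq> D \<longrightarrow> D = C)"

definition graded_poset_with_min :: "'a rel \<Rightarrow> bool" where
  "graded_poset_with_min r \<longleftrightarrow>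
     finite (Field r) \<and> Partial_order r \<and> (\<exists>z. is_minimum r z) \<and>
     (\<forall>C D. maximal_chain r C \<and> maximal_chain r D \<longrightarrow> card C = card D)"

text \<open>The length of a longest chain of the interval from the minimum to \<open>x\<close> (in a graded poset, of
  any maximal one); a chain with \<open>k + 1\<close> elements has length \<open>k\<close>.\<close>

definition poset_rank :: "'a rel \<Rightarrow> 'a \<Rightarrow> nat" where
  "poset_rank r x = Max (card ` {C \<in> Chains r. C \<subseteq> under r x}) - 1"

text \<open>The Moebius function. The guard is only there for termination; it is \<open>0\<close> for
  \<open>x\<close> not below \<open>y\<close>.\<close>

function mobius :: "'a rel \<Rightarrow> 'a \<Rightarrow> 'a \<Rightarrow> int" where
  "mobius r x y =
     (if finite (Field r) \<and> Partial_order r \<and> (x, y) \<in> r then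
        if x = y then 1
        else - (\<Sum>z\<in>{z. (x, z) \<in> r \<and> (z, y) \<in> r \<and> z \<noteq> y}. mobius r x z)
      else 0)"
  by pat_completeness auto
termination
proof (relation "measure (\<lambda>(r, x, y). card (under r y))", goal_cases)
  case 1
  show ?case by simp
next
  case (2 r x y z)
  have fin: "finite (Field r)" and po: "Partial_order r" and zy: "(z, y) \<in> r" and ne: "z \<noteq> y"
    using 2 by auto
  have "trans r" "antisym r" "Refl r"
    using po by (auto simp: partial_order_on_def preorder_on_def)
  have "under r z \<subset> under r y"
  proof
    show "under r z \<subseteq> under r y"
      using zy \<open>trans r\<close> by (auto simp: under_def dest: transD)
    have "y \<in> under r y"
      using zy \<open>Refl r\<close> by (auto simp: under_def refl_on_def Field_def)
    moreover have "y \<notin> under r z"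
      using zy ne \<open>antisym r\<close> by (auto simp: under_def dest: antisymD)
    ultimately show "under r z \<noteq> under r y" by blast
  qed
  moreover have "finite (under r y)"
    by (rule finite_subset[OF _ fin]) (auto simp: under_def Field_def)
  ultimately show ?case by (simp add: psubset_card_mono)
qed

declare mobius.simps [simp del]

definition whitney_first :: "'a rel \<Rightarrow> nat \<Rightarrow> int" where
  "whitney_first r k = (\<Sum>x\<in>{x \<in> Field r. poset_rank r x = k}. mobius r (minimum r) x)"

definition whitney_second :: "'a rel \<Rightarrow> nat \<Rightarrow> nat" where
  "whitney_second r k = card {x \<in> Field r. poset_rank r x = k}"

definition whitney_duals :: "'a rel \<Rightarrow> 'b rel \<Rightarrow> bool" where
  "whitney_duals r s \<longleftrightarrow>
     graded_poset_with_min r \<and> graded_poset_with_min s \<and>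
     (\<forall>k. \<bar>whitney_first r k\<bar> = int (whitney_second s k) \<and>
          \<bar>whitney_first s k\<bar> = int (whitney_second r k))"

section \<open>Pointed and weighted partitions\<close>

text \<open>The pair \<open>(A, p)\<close> encodes the pointed block \<open>A\<^sup>p\<close>, respectively the weighted
  block. Injectivity of \<open>fst\<close> says that each underlying set carries a single decoration.\<close>

definition decorated_partitions ::
  "(nat set \<Rightarrow> nat set) \<Rightarrow> nat \<Rightarrow> (nat set \<times> nat) set set" where
  "decorated_partitions dec n =
     {\<pi>. inj_on fst \<pi> \<and> partition_on {1..n} (fst ` \<pi>) \<and> (\<forall>(A, v)\<in>\<pi>. v \<in> dec A)}"

definition pointed_partitions :: "nat \<Rightarrow> (nat set \<times> nat) set set" where
  "pointed_partitions = decorated_partitions (\<lambda>A. A)"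

definition weighted_partitions :: "nat \<Rightarrow> (nat set \<times> nat) set set" where
  "weighted_partitions = decorated_partitions (\<lambda>A. {0..card A - 1})"

definition pointed_cover :: "(nat set \<times> nat) set \<Rightarrow> (nat set \<times> nat) set \<Rightarrow> bool" where
  "pointed_cover \<pi> \<pi>' \<longleftrightarrow>
     (\<exists>A p B q. (A, p) \<in> \<pi> \<and> (B, q) \<in> \<pi> \<and> (A, p) \<noteq> (B, q) \<and>
        (\<exists>s\<in>{p, q}. \<pi>' = insert (A \<union> B, s) (\<pi> - {(A, p), (B, q)})))"

definition weighted_cover :: "(nat set \<times> nat) set \<Rightarrow> (nat set \<times> nat) set \<Rightarrow> bool" where
  "weighted_cover \<pi> \<pi>' \<longleftrightarrow>
     (\<exists>A a B b. (A, a) \<in> \<pi> \<and> (B, b) \<in> \<pi> \<and> (A, a) \<noteq> (B, b) \<and>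
        (\<exists>u\<in>{0, 1}. \<pi>' = insert (A \<union> B, a + b + u) (\<pi> - {(A, a), (B, b)})))"

definition pointed_partition_poset :: "nat \<Rightarrow> (nat set \<times> nat) set rel" where
  "pointed_partition_poset n = generated_order (pointed_partitions n) pointed_cover"

definition weighted_partition_poset :: "nat \<Rightarrow> (nat set \<times> nat) set rel" where
  "weighted_partition_poset n = generated_order (weighted_partitions n) weighted_cover"

section \<open>Bicolored binary trees\<close>

text \<open>The colors \<open>0\<close> and \<open>1\<close> are \<open>False\<close> and \<open>True\<close>, with their library order
  \<open>False < True\<close>.\<close>

datatype btree = Leaf nat | Node (color: bool) (left: btree) (right: btree)

fun leaves :: "btree \<Rightarrow> nat list" where
  "leaves (Leaf i) = [i]"
| "leaves (Node c L R) = leaves L @ leaves R"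

fun subtrees :: "btree \<Rightarrow> btree set" where
  "subtrees (Leaf i) = {Leaf i}"
| "subtrees (Node c L R) = insert (Node c L R) (subtrees L \<union> subtrees R)"

definition internal :: "btree \<Rightarrow> bool" where
  "internal v \<longleftrightarrow> (\<exists>c L R. v = Node c L R)"

text \<open>The internal vertices of a tree, each given by the subtree rooted at it.\<close>

definition vertices :: "btree \<Rightarrow> btree set" where
  "vertices T = {v \<in> subtrees T. internal v}"

definition nu :: "btree \<Rightarrow> nat" where
  "nu v = Min (set (leaves v))"

definition normalized :: "btree \<Rightarrow> bool" where
  "normalized T \<longleftrightarrow> (\<forall>v\<in>vertices T. nu v = nu (left v))"

definition lyndon_vertex :: "btree \<Rightarrow> bool" where
  "lyndon_vertex v \<longleftrightarrow> \<not> internal (left v) \<or> nu (right (left v)) > nu (right v)"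

definition pointed_lyndon :: "btree \<Rightarrow> bool" where
  "pointed_lyndon T \<longleftrightarrow> normalized T \<and>
     (\<forall>v\<in>vertices T. internal (left v) \<longrightarrow>
        color (left v) \<ge> color v \<and>
        (color (left v) = True \<and> color v = True \<longrightarrow> lyndon_vertex v))"

definition bicolored_lyndon :: "btree \<Rightarrow> bool" where
  "bicolored_lyndon T \<longleftrightarrow> normalized T \<and>
     (\<forall>v\<in>vertices T. internal (left v) \<longrightarrow> lyndon_vertex v \<or> color (left v) > color v)"

section \<open>Merging and the posets of Lyndon forests\<close>

text \<open>\<open>graft u S T j\<close> joins \<open>S\<close> and \<open>T\<close> under a new vertex \<open>r\<close> of color \<open>u\<close>, to which the
  replacement of \<open>r(x(X\<^sub>L, X\<^sub>R), Y)\<close> by \<open>x(r(X\<^sub>L, Y), X\<^sub>R)\<close> has then been applied \<open>j\<close> times.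
  At most \<open>left_depth S\<close> replacements are possible.\<close>

fun graft :: "bool \<Rightarrow> btree \<Rightarrow> btree \<Rightarrow> nat \<Rightarrow> btree" where
  "graft u (Node c L R) T (Suc j) = Node c (graft u L T j) R"
| "graft u S T j = Node u S T"

fun left_depth :: "btree \<Rightarrow> nat" where
  "left_depth (Leaf i) = 0"
| "left_depth (Node c L R) = Suc (left_depth L)"

text \<open>\<open>M\<close> is the \<open>u\<close>-merge of \<open>S\<close> and \<open>T\<close> for trees of type \<open>ok\<close>: the replacement is
  performed as long as the whole tree is not of that type.\<close>

definition is_merge :: "(btree \<Rightarrow> bool) \<Rightarrow> bool \<Rightarrow> btree \<Rightarrow> btree \<Rightarrow> btree \<Rightarrow> bool" where
  "is_merge ok u S T M \<longleftrightarrow>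
     (\<exists>j\<le>left_depth S. M = graft u S T j \<and> ok M \<and> (\<forall>i<j. \<not> ok (graft u S T i)))"

definition forests :: "(btree \<Rightarrow> bool) \<Rightarrow> nat \<Rightarrow> btree set set" where
  "forests ok n =
     {F. (\<forall>T\<in>F. distinct (leaves T) \<and> ok T) \<and>
         (\<forall>S\<in>F. \<forall>T\<in>F. S \<noteq> T \<longrightarrow> set (leaves S) \<inter> set (leaves T) = {}) \<and>
         (\<Union>T\<in>F. set (leaves T)) = {1..n}}"

definition merge_cover :: "(btree \<Rightarrow> bool) \<Rightarrow> btree set \<Rightarrow> btree set \<Rightarrow> bool" where
  "merge_cover ok F F' \<longleftrightarrow>
     (\<exists>S\<in>F. \<exists>T\<in>F. nu S < nu T \<and>
        (\<exists>u M. is_merge ok u S T M \<and> F' = insert M (F - {S, T})))"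

definition FLyn_pointed :: "nat \<Rightarrow> btree set rel" where
  "FLyn_pointed n = generated_order (forests pointed_lyndon n) (merge_cover pointed_lyndon)"

definition FLyn_weighted :: "nat \<Rightarrow> btree set rel" where
  "FLyn_weighted n = generated_order (forests bicolored_lyndon n) (merge_cover bicolored_lyndon)"

end

theory Submission
  imports Defs "HOL-Library.FuncSet"
begin

text \<open>To tell the two posets of forests apart, count for an atom \<open>a\<close> the elements that cover \<open>a\<close> and
  nothing else. For the atom in which \<open>i < j\<close> are merged with color \<open>u\<close>, the number in the pointed
  poset is \<open>2(i - 1)\<close>, plus \<open>n - i - 1\<close> if \<open>u = 0\<close>; for \<open>n \<ge> 4\<close> this is never \<open>1\<close>. In the weighted poset
  it is \<open>1\<close> for \<open>i = 1\<close>, \<open>j = 3\<close>, \<open>u = 0\<close>.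

  In both partition posets the number of elements of rank \<open>m\<close> above an element of rank \<open>k\<close> is
  \<open>(n - k choose n - m) (n - m)\<^sup>m\<^sup>-\<^sup>k\<close>. So the Whitney numbers of the second kind are
  \<open>W\<^sub>k = (n choose k) (n - k)\<^sup>k\<close>, and summing the Moebius function over all pairs with upper element of rank
  \<open>m\<close> gives a triangular linear system for the Whitney numbers of the first kind, whose solution is
  \<open>w\<^sub>k = (-1)\<^sup>k (n - 1 choose k) n\<^sup>k\<close>.

  As \<open>W\<^sub>k + \<bar>w\<^sub>k\<^sub>-\<^sub>1\<bar> \<le> \<bar>w\<^sub>k\<bar>\<close> for \<open>2 \<le> k < n\<close>, there is room for graded posets with \<open>\<bar>w\<^sub>k\<bar>\<close> elements of
  rank \<open>k\<close>, of which \<open>W\<^sub>k\<close> have Moebius value \<open>(-1)\<^sup>k\<close> and the others \<open>0\<close>. Such layered posets are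
  Whitney duals of both partition posets, and changing one of them locally, without changing its
  Whitney numbers, yields a non-isomorphic one. The posets of forests are not used here.\<close>

section \<open>Orders generated by rank-increasing steps\<close>

text \<open>Whitney duality as defined compares only two pairs of number sequences, so posets that
  have nothing to do with partitions or trees can serve as duals once the numbers are known. The
  obstacle is then gradedness: every element below the top rank must be covered by something,
  although the Moebius values are prescribed. Elements covering a single element settle this,
  because they extend chains and contribute nothing to the Moebius sums. At \<open>k = 1\<close> the
  inequality fails by one, but the single minimum is covered by every atom anyway. The forests are
  told apart by how far the two replacement rules commute. A tree on three leaves grown from an atom
  often arises from a second atom too, since replacement turns both orders of insertion into the
  same tree. In the pointed type, two vertices of color 0 obey no Lyndon condition, so both orders
  survive as different trees, each with a single lower cover. In the bicolored type they are
  identified, and a single lower cover needs a coincidence of colors and labels that can occur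
  exactly once.\<close>

definition covers :: "'a rel \<Rightarrow> 'a \<Rightarrow> 'a \<Rightarrow> bool" where
  "covers r x y \<longleftrightarrow> (x, y) \<in> r \<and> x \<noteq> y \<and> (\<forall>w. (x, w) \<in> r \<and> (w, y) \<in> r \<longrightarrow> w = x \<or> w = y)"

locale ranked_steps =
  fixes C :: "'a set" and step :: "'a \<Rightarrow> 'a \<Rightarrow> bool" and rk :: "'a \<Rightarrow> nat"
  assumes rk_step: "u \<in> C \<Longrightarrow> v \<in> C \<Longrightarrow> step u v \<Longrightarrow> rk v = Suc (rk u)"
begin

abbreviation ord :: "'a rel" where "ord \<equiv> generated_order C step"

lemma ord_refl: "x \<in> C \<Longrightarrow> (x, x) \<in> ord"
  by (simp add: generated_order_def)

lemma ord_step: "u \<in> C \<Longrightarrow> v \<in> C \<Longrightarrow> step u v \<Longrightarrow> (u, v) \<in> ord"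
  by (auto simp: generated_order_def)

lemma ord_trans: "(x, y) \<in> ord \<Longrightarrow> (y, w) \<in> ord \<Longrightarrow> (x, w) \<in> ord"
  by (auto simp: generated_order_def)

lemma ord_carrier: "(x, y) \<in> ord \<Longrightarrow> x \<in> C \<and> y \<in> C"
  by (auto simp: generated_order_def)

lemma ord_induct [consumes 1, case_names refl step]:
  assumes "(x, y) \<in> ord"
    and "x \<in> C \<Longrightarrow> Q x"
    and "\<And>u v. (x, u) \<in> ord \<Longrightarrow> Q u \<Longrightarrow> v \<in> C \<Longrightarrow> step u v \<Longrightarrow> Q v"
  shows "Q y"
proof -
  let ?s = "{(u, v). u \<in> C \<and> v \<in> C \<and> step u v}"
  have x: "x \<in> C" and r: "(x, y) \<in> ?s\<^sup>*"
    using assms(1) by (auto simp: generated_order_def)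
  from r have "Q y \<and> y \<in> C"
  proof (induction rule: rtrancl_induct)
    case base
    then show ?case using assms(2) x by simp
  next
    case (step u v)
    then show ?case using assms(3)[of u v] x by (auto simp: generated_order_def)
  qed
  then show ?thesis by simp
qed

lemma ord_rk: "(x, y) \<in> ord \<Longrightarrow> x = y \<or> rk x < rk y"
  by (induction rule: ord_induct) (auto dest!: ord_carrier simp: rk_step)

lemma ord_last_step:
  assumes "(x, y) \<in> ord" "x \<noteq> y"
  obtains u where "(x, u) \<in> ord" "u \<in> C" "step u y"
proof -
  have "x = y \<or> (\<exists>u. (x, u) \<in> ord \<and> u \<in> C \<and> step u y)"
    using assms(1) by (induction rule: ord_induct) (auto dest: ord_carrier)
  then show thesis using assms(2) that by auto
qed

lemma ord_first_step:
  assumes "(x, y) \<in> ord" "x \<noteq> y"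
  obtains u where "u \<in> C" "step x u" "(u, y) \<in> ord"
proof -
  have "x = y \<or> (\<exists>u. u \<in> C \<and> step x u \<and> (u, y) \<in> ord)"
    using assms(1) 
  proof (induction rule: ord_induct)
    case (step u v)
    then show ?case using ord_refl ord_step ord_trans ord_carrier by metis
  qed auto
  then show thesis using assms(2) that by auto
qed

lemma Field_ord: "Field ord = C"
  using ord_refl ord_carrier by (auto simp: Field_def)

lemma Partial_order_ord: "Partial_order ord"
proof -
  have "antisym ord"
    by (rule antisymI) (use ord_rk in \<open>fastforce dest: ord_rk\<close>)
  moreover have "trans ord" by (rule transI) (rule ord_trans)
  moreover have "Refl ord"
    unfolding refl_on_def Field_ord using ord_refl ord_carrier by auto
  moreover have "ord \<subseteq> Field ord \<times> Field ord" by (auto simp: Field_def)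
  ultimately show ?thesis by (simp add: partial_order_on_def preorder_on_def)
qed

text \<open>A step raises the rank by exactly one, so nothing fits in between. Conversely, the first
  step of a path from \<open>x\<close> to \<open>y\<close> lies in the interval and must already be
  \<open>y\<close>.\<close>

lemma covers_iff_step: "covers ord x y \<longleftrightarrow> x \<in> C \<and> y \<in> C \<and> step x y"
proof
  assume c: "covers ord x y"
  then have "(x, y) \<in> ord" "x \<noteq> y" by (auto simp: covers_def)
  then obtain u where u: "u \<in> C" "step x u" "(u, y) \<in> ord" by (rule ord_first_step)
  have "x \<in> C" using c by (auto simp: covers_def dest: ord_carrier)
  have "u \<noteq> x" using rk_step[of x u] u \<open>x \<in> C\<close> by auto
  then have "u = y" using c u(3) ord_step[OF \<open>x \<in> C\<close> u(1,2)] unfolding covers_def by blast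
  then show "x \<in> C \<and> y \<in> C \<and> step x y" using u \<open>x \<in> C\<close> by simp
next
  assume s: "x \<in> C \<and> y \<in> C \<and> step x y"
  then have "rk y = Suc (rk x)" using rk_step by blast
  then show "covers ord x y"
    unfolding covers_def using s ord_step ord_rk
    by (metis Suc_leI leD less_not_refl2 lessI)
qed

end

lemma poset_isomorphic_covers:
  assumes "bij_betw f (Field r) (Field s)"
    and "\<forall>x\<in>Field r. \<forall>y\<in>Field r. (x, y) \<in> r \<longleftrightarrow> (f x, f y) \<in> s"
    and "x \<in> Field r" "y \<in> Field r"
  shows "covers r x y \<longleftrightarrow> covers s (f x) (f y)"
proof -
  have inj: "f u = f v \<longleftrightarrow> u = v" if "u \<in> Field r" "v \<in> Field r" for u v
    using assms(1) that by (auto simp: bij_betw_def inj_on_def)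
  have sur: "\<exists>u\<in>Field r. w = f u" if "w \<in> Field s" for w
    using assms(1) that by (auto simp: bij_betw_def)
  have F: "(u, v) \<in> r \<Longrightarrow> u \<in> Field r \<and> v \<in> Field r" for u v
    by (auto simp: Field_def)
  have F': "(u, v) \<in> s \<Longrightarrow> u \<in> Field s \<and> v \<in> Field s" for u v
    by (auto simp: Field_def)
  show ?thesis
  proof
    assume c: "covers r x y"
    show "covers s (f x) (f y)"
      unfolding covers_def
    proof (intro conjI allI impI)
      fix w assume w: "(f x, w) \<in> s \<and> (w, f y) \<in> s"
      then obtain u where "u \<in> Field r" "w = f u" using sur F' by metis
      then have "u = x \<or> u = y" using w c assms unfolding covers_def by blast
      then show "w = f x \<or> w = f y" using \<open>w = f u\<close> by blast
    qed (use c assms inj in \<open>auto simp: covers_def\<close>)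
  next
    assume c: "covers s (f x) (f y)"
    show "covers r x y"
      unfolding covers_def
    proof (intro conjI allI impI)
      fix w assume w: "(x, w) \<in> r \<and> (w, y) \<in> r"
      then have "w \<in> Field r" using F by auto
      then have "f w = f x \<or> f w = f y" using w c assms unfolding covers_def by blast
      then show "w = x \<or> w = y" using inj \<open>w \<in> Field r\<close> assms by simp
    qed (use c assms inj in \<open>auto simp: covers_def\<close>)
  qed
qed

section \<open>Graded posets with a minimum: ranks, maximal chains, Moebius sums\<close>

locale graded_steps = ranked_steps +
  fixes z :: 'a and N :: nat
  assumes finite_C: "finite C"
    and z_C: "z \<in> C" and rk_z: "rk z = 0"
    and z_le: "x \<in> C \<Longrightarrow> (z, x) \<in> generated_order C step"
    and rk_le: "x \<in> C \<Longrightarrow> rk x \<le> N"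
    and up: "x \<in> C \<Longrightarrow> rk x < N \<Longrightarrow> \<exists>y\<in>C. step x y"
begin

lemma rk_pos: "x \<in> C \<Longrightarrow> x \<noteq> z \<Longrightarrow> 0 < rk x"
  using ord_rk[OF z_le, of x] by auto

lemma is_minimum_z: "is_minimum ord z"
  by (simp add: is_minimum_def Field_ord z_C z_le)

lemma minimum_ord: "minimum ord = z"
  unfolding minimum_def
proof (rule the_equality)
  show "is_minimum ord z" by (rule is_minimum_z)
next
  fix w assume "is_minimum ord w"
  then have "w \<in> C" "(w, z) \<in> ord" using z_C by (auto simp: is_minimum_def Field_ord)
  then show "w = z" using ord_rk[of w z] rk_z by auto
qed

lemma finite_ord: "finite (Field ord)"
  by (simp add: Field_ord finite_C)

lemma under_subset: "under ord x \<subseteq> C"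
  by (auto simp: under_def dest: ord_carrier)

lemma under_z: "under ord z = {z}"
proof -
  have "x = z" if "(x, z) \<in> ord" for x using ord_rk[OF that] rk_z by simp
  then show ?thesis using z_C ord_refl by (auto simp: under_def)
qed

lemma Chains_subset: "D \<in> Chains ord \<Longrightarrow> D \<subseteq> C"
  by (auto simp: Chains_def dest: ord_carrier)

lemma inj_on_rk_chain: "D \<in> Chains ord \<Longrightarrow> inj_on rk D"
  unfolding Chains_def inj_on_def by (fastforce dest: ord_rk)

lemma chain_to:
  assumes "x \<in> C"
  shows "\<exists>D\<in>Chains ord. D \<subseteq> under ord x \<and> card D = Suc (rk x)"
proof -
  have "(z, x) \<in> ord" using assms by (rule z_le)
  then show ?thesis
  proof (induction rule: ord_induct)
    case refl
    show ?case
      by (rule bexI[of _ "{z}"]) (auto simp: Chains_def under_def ord_refl z_C rk_z)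
  next
    case (step u v)
    then obtain D where D: "D \<in> Chains ord" "D \<subseteq> under ord u" "card D = Suc (rk u)" by auto
    have u: "u \<in> C" using step ord_carrier by auto
    have uv: "(u, v) \<in> ord" using step u by (simp add: ord_step)
    have Dv: "(d, v) \<in> ord" if "d \<in> D" for d
      using D(2) that uv by (auto simp: under_def intro: ord_trans)
    have rkv: "rk v = Suc (rk u)" using rk_step step u by simp
    have "v \<notin> D"
    proof
      assume "v \<in> D"
      then have "(v, u) \<in> ord" using D(2) by (auto simp: under_def)
      then show False using ord_rk[of v u] rkv by auto
    qed
    moreover have "finite D" using Chains_subset[OF D(1)] finite_C finite_subset by auto
    ultimately have "card (insert v D) = Suc (rk v)" using D(3) rkv by simp
    moreover have "insert v D \<in> Chains ord"
      using D(1) Dv ord_refl[OF \<open>v \<in> C\<close>] by (auto simp: Chains_def)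
    moreover have "insert v D \<subseteq> under ord v"
      using Dv ord_refl[OF \<open>v \<in> C\<close>] by (auto simp: under_def)
    ultimately show ?case by blast
  qed
qed

text \<open>Along a chain below \<open>x\<close> the function \<open>rk\<close> is injective with
  values in \<open>0..rk x\<close>; the chain of steps from \<open>z\<close> to \<open>x\<close>
  attains the bound.\<close>

lemma poset_rank_ord:
  assumes "x \<in> C"
  shows "poset_rank ord x = rk x"
proof -
  let ?S = "card ` {D \<in> Chains ord. D \<subseteq> under ord x}"
  have le: "c \<le> Suc (rk x)" if "c \<in> ?S" for c
  proof -
    from that obtain D where D: "D \<in> Chains ord" "D \<subseteq> under ord x" "c = card D" by auto
    have "rk ` D \<subseteq> {..rk x}"
      using D(2) by (auto simp: under_def dest!: ord_rk)
    then have "card (rk ` D) \<le> Suc (rk x)"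
      using card_mono[of "{..rk x}" "rk ` D"] by simp
    then show ?thesis using D inj_on_rk_chain card_image by metis
  qed
  have "finite ?S" using le by (meson atMost_iff finite_atMost finite_subset subsetI)
  moreover have "Suc (rk x) \<in> ?S"
    using chain_to[OF assms] by force
  ultimately have "Max ?S = Suc (rk x)"
    using le by (intro Max_eqI) auto
  then show ?thesis by (simp add: poset_rank_def)
qed

text \<open>A maximal chain contains exactly one element of each rank \<open>0..N\<close>: wherever
  a rank is missing, a step leads to an element comparable with the whole chain.\<close>

lemma card_maximal_chain:
  assumes "maximal_chain ord D"
  shows "card D = Suc N"
proof -
  have D: "D \<in> Chains ord" and mx: "\<And>E. E \<in> Chains ord \<Longrightarrow> D \<subseteq> E \<Longrightarrow> E = D"
    using assms by (auto simp: maximal_chain_def)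
  have DC: "D \<subseteq> C" by (rule Chains_subset[OF D])
  have ins: "w \<in> D" if "w \<in> C" "\<And>d. d \<in> D \<Longrightarrow> (w, d) \<in> ord \<or> (d, w) \<in> ord" for w
  proof -
    have "insert w D \<in> Chains ord"
      using D that ord_refl by (auto simp: Chains_def)
    then show ?thesis using mx[of "insert w D"] by auto
  qed
  have "\<exists>d\<in>D. rk d = k" if "k \<le> N" for k
    using that
  proof (induction k)
    case 0
    have "z \<in> D" by (rule ins) (use z_C z_le DC in auto)
    then show ?case using rk_z by auto
  next
    case (Suc k)
    then obtain d where d: "d \<in> D" "rk d = k" by auto
    have dC: "d \<in> C" using d DC by auto
    have cmp: "(a, b) \<in> ord \<or> (b, a) \<in> ord" if "a \<in> D" "b \<in> D" for a b
      using D that by (auto simp: Chains_def)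
    show ?case
    proof (cases "\<exists>e\<in>D. rk e > k")
      case False
      \<comment> \<open>Here \<open>d\<close> is the top of the chain, so any step upwards from it
        would extend the chain.\<close>
      obtain y where y: "y \<in> C" "step d y" using up[OF dC] d Suc.prems by auto
      have "y \<in> D"
      proof (rule ins[OF y(1)])
        fix e assume e: "e \<in> D"
        then have "(e, d) \<in> ord" using cmp[OF e d(1)] False d ord_rk[of d e] by auto
        then show "(y, e) \<in> ord \<or> (e, y) \<in> ord"
          using ord_step[OF dC y] ord_trans by blast
      qed
      then show ?thesis using rk_step[OF dC y] d by auto
    next
      case True
      \<comment> \<open>\<open>e\<close> is the next chain element above \<open>d\<close>; the first
        step from \<open>d\<close> towards \<open>e\<close> is comparable with everything in the
        chain.\<close>
      then obtain e where e: "e \<in> D" "rk e > k" and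
        emin: "\<And>e'. e' \<in> D \<Longrightarrow> rk e' > k \<Longrightarrow> rk e \<le> rk e'"
        using ex_has_least_nat[of "\<lambda>e. e \<in> D \<and> rk e > k" _ rk] by blast
      have "(d, e) \<in> ord" "d \<noteq> e" using cmp[OF d(1) e(1)] d e ord_rk[of e d] by auto
      then obtain y where y: "y \<in> C" "step d y" "(y, e) \<in> ord" by (rule ord_first_step)
      have "y \<in> D"
      proof (rule ins[OF y(1)])
        fix f assume f: "f \<in> D"
        show "(y, f) \<in> ord \<or> (f, y) \<in> ord"
        proof (cases "rk f > k")
          case True
          then have "(e, f) \<in> ord" using cmp[OF e(1) f] emin[OF f] ord_rk[of f e] by auto
          then show ?thesis using y ord_trans by blast
        next
          case False
          then have "(f, d) \<in> ord" using cmp[OF f d(1)] d ord_rk[of d f] by auto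
          then show ?thesis using ord_step[OF dC y(1,2)] ord_trans by blast
        qed
      qed
      then show ?thesis using rk_step[OF dC y(1,2)] d by auto
    qed
  qed
  then have "rk ` D = {..N}" using rk_le DC by force
  then have "card (rk ` D) = Suc N" by simp
  then show ?thesis using inj_on_rk_chain[OF D] by (simp add: card_image)
qed

lemma graded_ord: "graded_poset_with_min ord"
  unfolding graded_poset_with_min_def
  using finite_ord Partial_order_ord is_minimum_z card_maximal_chain by auto

lemma whitney_second_ord: "whitney_second ord k = card {x \<in> C. rk x = k}"
  unfolding whitney_second_def Field_ord using poset_rank_ord by (metis (mono_tags, lifting))

lemma whitney_first_ord: "whitney_first ord k = (\<Sum>x\<in>{x \<in> C. rk x = k}. mobius ord z x)"
  unfolding whitney_first_def Field_ord minimum_ord using poset_rank_ord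
  by (intro sum.cong) auto

lemma mobius_sum_under:
  assumes "x \<in> C"
  shows "(\<Sum>y\<in>under ord x. mobius ord z y) = (if x = z then 1 else 0)"
proof -
  have fin: "finite (under ord x)" using under_subset finite_C finite_subset by blast
  have x: "x \<in> under ord x" using assms ord_refl by (simp add: under_def)
  have eq: "{y. (z, y) \<in> ord \<and> (y, x) \<in> ord \<and> y \<noteq> x} = under ord x - {x}"
    using z_le ord_carrier by (auto simp: under_def)
  have "(\<Sum>y\<in>under ord x. mobius ord z y) = mobius ord z x + (\<Sum>y\<in>under ord x - {x}. mobius ord z y)"
    using fin x by (simp add: sum.remove)
  moreover have "under ord z = {z}" by (rule under_z)
  ultimately show ?thesis
    using finite_ord Partial_order_ord z_le[OF assms] eq
    by (auto simp: mobius.simps[of ord z x])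
qed

text \<open>The recursion for the Moebius function has a unique solution, so a guessed function only
  has to be checked on lower sets.\<close>

lemma mobius_eqI:
  assumes "f z = 1" "\<And>x. x \<in> C \<Longrightarrow> x \<noteq> z \<Longrightarrow> (\<Sum>y\<in>under ord x. f y) = 0" "x \<in> C"
  shows "mobius ord z x = f x"
  using assms(3)
proof (induction "rk x" arbitrary: x rule: less_induct)
  case less
  have fin: "finite (under ord x)" using under_subset finite_C finite_subset by blast
  have x: "x \<in> under ord x" using less.prems ord_refl by (simp add: under_def)
  have "mobius ord z y = f y" if "y \<in> under ord x - {x}" for y
  proof (rule less.hyps)
    show "rk y < rk x" using that ord_rk[of y x] by (auto simp: under_def)
    show "y \<in> C" using that under_subset by auto
  qed
  then have "(\<Sum>y\<in>under ord x - {x}. mobius ord z y) = (\<Sum>y\<in>under ord x - {x}. f y)"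
    by (intro sum.cong) auto
  moreover have "(\<Sum>y\<in>under ord x. mobius ord z y) = (\<Sum>y\<in>under ord x. f y)"
  proof (cases "x = z")
    case True
    show ?thesis using mobius_sum_under[OF less.prems] True assms(1) under_z by simp
  next
    case False
    then show ?thesis using mobius_sum_under[OF less.prems] assms(2)[OF less.prems] by simp
  qed
  ultimately show ?case using fin x by (simp add: sum.remove)
qed

text \<open>Double counting of the pairs \<open>x <= y\<close> with \<open>rk y = m\<close>,
  weighted by the Moebius value of \<open>x\<close>: for fixed \<open>y\<close> the weights cancel
  since \<open>m > 0\<close>, for fixed \<open>x\<close> there are \<open>U (rk x)\<close> choices
  of \<open>y\<close>.\<close>

lemma whitney_first_recurrence:
  assumes "\<And>x. x \<in> C \<Longrightarrow> rk x \<le> m \<Longrightarrow> card {y \<in> C. (x, y) \<in> ord \<and> rk y = m} = U (rk x)" "0 < m"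
  shows "(\<Sum>k\<le>m. whitney_first ord k * int (U k)) = 0"
proof -
  let ?L = "{y \<in> C. rk y = m}" and ?mu = "mobius ord z"
  let ?B = "{x \<in> C. rk x \<le> m}"
  have "0 = (\<Sum>y\<in>?L. \<Sum>x\<in>under ord y. ?mu x)"
    using mobius_sum_under rk_z assms(2) by (intro sum.neutral[symmetric]) auto
  also have "\<dots> = (\<Sum>y\<in>?L. \<Sum>x\<in>{x. x \<in> ?B \<and> (x, y) \<in> ord}. ?mu x)"
  proof (intro sum.cong refl)
    fix y assume "y \<in> ?L"
    then show "under ord y = {x. x \<in> ?B \<and> (x, y) \<in> ord}"
      by (auto simp: under_def dest: ord_carrier ord_rk)
  qed
  also have "\<dots> = (\<Sum>x\<in>?B. \<Sum>y\<in>{y. y \<in> ?L \<and> (x, y) \<in> ord}. ?mu x)"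
    using finite_C by (intro sum.swap_restrict) auto
  also have "\<dots> = (\<Sum>x\<in>?B. ?mu x * int (U (rk x)))"
  proof (intro sum.cong refl)
    fix x assume "x \<in> ?B"
    moreover have "{y. y \<in> ?L \<and> (x, y) \<in> ord} = {y \<in> C. (x, y) \<in> ord \<and> rk y = m}" by auto
    ultimately show "(\<Sum>y\<in>{y. y \<in> ?L \<and> (x, y) \<in> ord}. ?mu x) = ?mu x * int (U (rk x))"
      using assms(1)[of x] by simp
  qed
  also have "\<dots> = (\<Sum>k\<le>m. \<Sum>x\<in>{x. x \<in> ?B \<and> rk x = k}. ?mu x * int (U (rk x)))"
    using finite_C by (intro sum.group[symmetric]) auto
  also have "\<dots> = (\<Sum>k\<le>m. whitney_first ord k * int (U k))"
  proof (intro sum.cong refl)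
    fix k assume "k \<in> {..m}"
    then have "{x. x \<in> ?B \<and> rk x = k} = {x \<in> C. rk x = k}" by auto
    then show "(\<Sum>x\<in>{x. x \<in> ?B \<and> rk x = k}. ?mu x * int (U (rk x))) = whitney_first ord k * int (U k)"
      by (simp add: whitney_first_ord sum_distrib_right)
  qed
  finally show ?thesis by simp
qed

lemma whitney_first_0: "whitney_first ord 0 = 1"
proof -
  have "{x \<in> C. rk x = 0} = {z}" using rk_pos z_C rk_z by fastforce
  moreover have "under ord z = {z}" by (rule under_z)
  ultimately show ?thesis using mobius_sum_under[OF z_C] by (simp add: whitney_first_ord)
qed

end

section \<open>Enumerative identities\<close>

text \<open>The product counts the ways to choose a representative in each block. A partition with
  representatives amounts to the set \<open>S\<close> of representatives and the map from the other
  elements to \<open>S\<close> that sends each one to the representative of its block.\<close>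

lemma sum_prod_card_partitions:
  fixes X :: "'a set"
  assumes "finite X"
  shows "(\<Sum>P\<in>{P. partition_on X P \<and> card P = s}. \<Prod>B\<in>P. card B) = (card X choose s) * s ^ (card X - s)"
proof -
  let ?Ps = "{P. partition_on X P \<and> card P = s}"
  let ?Ss = "{S. S \<subseteq> X \<and> card S = s}"
  let ?L = "Sigma ?Ps (\<lambda>P. PiE P (\<lambda>B. B))" and ?R = "Sigma ?Ss (\<lambda>S. PiE (X - S) (\<lambda>_. S))"
  \<comment> \<open>\<open>blk S g t\<close> is the block represented by \<open>t\<close>;
    \<open>F\<close> and \<open>G\<close> are the two directions of the bijection. Restricted
    functions are used so that they are inverse on the nose.\<close>
  define blk where "blk = (\<lambda>S (g :: 'a \<Rightarrow> 'a) t. insert t {x \<in> X - S. g x = t})"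
  define F where "F = (\<lambda>(P, h). (h ` P, \<lambda>x\<in>X - h ` P. h (THE B. B \<in> P \<and> x \<in> B)))"
  define G where "G = (\<lambda>(S, g). (blk S g ` S, \<lambda>B\<in>blk S g ` S. (THE t. t \<in> S \<and> t \<in> B)))"
  have finPs: "finite ?Ps"
    by (rule finite_subset[of _ "Pow (Pow X)"]) (use assms in \<open>auto simp: partition_on_def\<close>)
  have finP: "finite P" if "partition_on X P" for P
    using that assms by (auto intro: finite_elements)
  have finB: "finite B" if "partition_on X P" "B \<in> P" for P B
    using that assms by (metis Sup_upper finite_subset partition_onD1)
  have the_blk: "(THE B. B \<in> P \<and> x \<in> B) = B" if "partition_on X P" "B \<in> P" "x \<in> B" for P B x
    using that by (intro the_equality) (auto simp: partition_on_def disjoint_def)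
  have bij: "bij_betw F ?L ?R"
  proof (rule bij_betw_byWitness[where f' = G])
    show "\<forall>a\<in>?L. G (F a) = a"
    proof
      fix a assume "a \<in> ?L"
      then obtain P h where a: "a = (P, h)" and P: "partition_on X P" and h: "h \<in> PiE P (\<lambda>B. B)"
        by auto
      have hB: "h B \<in> B" "h B \<in> X" if "B \<in> P" for B
        using h P that by (auto simp: partition_on_def PiE_def)
      define g where "g = (\<lambda>x\<in>X - h ` P. h (THE B. B \<in> P \<and> x \<in> B))"
      have eqh: "B = B'" if "B \<in> P" "B' \<in> P" "x \<in> B" "x \<in> B'" for B B' x
        using that P by (auto simp: partition_on_def disjoint_def)
      have injh: "B = B'" if "B \<in> P" "B' \<in> P" "h B = h B'" for B B'
        using eqh[OF that(1,2), of "h B"] hB[OF that(1)] hB[OF that(2)] that(3) by auto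
      have g: "g x = h B" if "B \<in> P" "x \<in> B" "x \<in> X - h ` P" for x B
        using that the_blk[OF P] by (simp add: g_def)
      have blkB: "blk (h ` P) g (h B) = B" if B: "B \<in> P" for B
      proof (rule set_eqI)
        fix x
        show "x \<in> blk (h ` P) g (h B) \<longleftrightarrow> x \<in> B"
        proof
          assume x: "x \<in> blk (h ` P) g (h B)"
          show "x \<in> B"
          proof (cases "x = h B")
            case True
            then show ?thesis using hB B by simp
          next
            case False
            then have x': "x \<in> X - h ` P" "g x = h B" using x by (auto simp: blk_def)
            then obtain B' where "B' \<in> P" "x \<in> B'" using P by (auto simp: partition_on_def)
            then show ?thesis using g[of B' x] x' injh[of B' B] B by auto
          qed
        next
          assume x: "x \<in> B"
          then have xX: "x \<in> X" using B P by (auto simp: partition_on_def)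
          show "x \<in> blk (h ` P) g (h B)"
          proof (cases "x \<in> h ` P")
            case True
            then obtain B' where "B' \<in> P" "x = h B'" by auto
            then have "x = h B" using eqh[of B B' x] hB[of B'] x B by auto
            then show ?thesis by (simp add: blk_def)
          next
            case False
            then show ?thesis using g[OF B x] xX by (simp add: blk_def)
          qed
        qed
      qed
      have 1: "blk (h ` P) g ` (h ` P) = P"
        using blkB by (auto simp: image_image)
      have 2: "(\<lambda>B\<in>P. (THE t. t \<in> h ` P \<and> t \<in> B)) = h"
      proof (rule ext)
        fix B
        show "(\<lambda>B\<in>P. (THE t. t \<in> h ` P \<and> t \<in> B)) B = h B"
        proof (cases "B \<in> P")
          case True
          have "(THE t. t \<in> h ` P \<and> t \<in> B) = h B"
          proof (rule the_equality)
            show "h B \<in> h ` P \<and> h B \<in> B" using True hB by auto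
          next
            fix t assume "t \<in> h ` P \<and> t \<in> B"
            then obtain B' where "B' \<in> P" "t = h B'" "t \<in> B" by auto
            then show "t = h B" using eqh[of B B' t] hB[of B'] True by auto
          qed
          then show ?thesis using True by simp
        next
          case False
          then show ?thesis using h by (auto simp: PiE_def extensional_def)
        qed
      qed
      have "F a = (h ` P, g)" by (simp add: F_def a g_def)
      then show "G (F a) = a" by (simp add: G_def a 1 2)
    qed
  next
    show "\<forall>b\<in>?R. F (G b) = b"
    proof
      fix b assume "b \<in> ?R"
      then obtain S g where b: "b = (S, g)" and S: "S \<subseteq> X" and g: "g \<in> PiE (X - S) (\<lambda>_. S)"
        by auto
      define h where "h = (\<lambda>B\<in>blk S g ` S. (THE t. t \<in> S \<and> t \<in> B))"
      have the: "(THE t'. t' \<in> S \<and> t' \<in> blk S g t) = t" if "t \<in> S" for t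
        using that by (intro the_equality) (auto simp: blk_def)
      have hb: "h (blk S g t) = t" if "t \<in> S" for t
        using that the by (simp add: h_def)
      have 1: "h ` (blk S g ` S) = S"
        using hb by (auto simp: image_image)
      have 2: "(\<lambda>x\<in>X - S. h (THE B. B \<in> blk S g ` S \<and> x \<in> B)) = g"
      proof (rule ext)
        fix x
        show "(\<lambda>x\<in>X - S. h (THE B. B \<in> blk S g ` S \<and> x \<in> B)) x = g x"
        proof (cases "x \<in> X - S")
          case True
          then have gx: "g x \<in> S" using g by auto
          have "(THE B. B \<in> blk S g ` S \<and> x \<in> B) = blk S g (g x)"
            by (rule the_equality) (use True gx in \<open>auto simp: blk_def\<close>)
          then show ?thesis using True hb[OF gx] by simp
        next
          case False
          then show ?thesis using g by (auto simp: PiE_def extensional_def)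
        qed
      qed
      have "G b = (blk S g ` S, h)" by (simp add: G_def b h_def)
      then show "F (G b) = b" by (simp add: F_def b 1 2)
    qed
  next
    show "F ` ?L \<subseteq> ?R"
    proof
      fix y assume "y \<in> F ` ?L"
      then obtain P h where y: "y = F (P, h)" and P: "partition_on X P" "card P = s"
        and h: "h \<in> PiE P (\<lambda>B. B)" by auto
      have hB: "h B \<in> B" "h B \<in> X" if "B \<in> P" for B
        using h P that by (auto simp: partition_on_def PiE_def)
      have "inj_on h P"
      proof (rule inj_onI)
        fix B B' assume "B \<in> P" "B' \<in> P" "h B = h B'"
        then have "h B \<in> B" "h B \<in> B'" using hB[of B] hB[of B'] by auto
        then show "B = B'" using P \<open>B \<in> P\<close> \<open>B' \<in> P\<close> by (auto simp: partition_on_def disjoint_def)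
      qed
      then have "card (h ` P) = s" using P by (simp add: card_image)
      moreover have "h ` P \<subseteq> X" using hB by auto
      moreover have "(\<lambda>x\<in>X - h ` P. h (THE B. B \<in> P \<and> x \<in> B)) \<in> PiE (X - h ` P) (\<lambda>_. h ` P)"
      proof (rule restrict_PiE_iff[THEN iffD2], rule ballI)
        fix x assume "x \<in> X - h ` P"
        then obtain B where "B \<in> P" "x \<in> B" using P by (auto simp: partition_on_def)
        then show "h (THE B. B \<in> P \<and> x \<in> B) \<in> h ` P" using the_blk[OF P(1)] by auto
      qed
      ultimately show "y \<in> ?R" by (simp add: y F_def)
    qed
  next
    show "G ` ?R \<subseteq> ?L"
    proof
      fix y assume "y \<in> G ` ?R"
      then obtain S g where y: "y = G (S, g)" and S: "S \<subseteq> X" "card S = s"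
        and g: "g \<in> PiE (X - S) (\<lambda>_. S)" by auto
      have inj: "inj_on (blk S g) S"
        by (rule inj_onI) (auto simp: blk_def)
      have "partition_on X (blk S g ` S)"
      proof (rule partition_onI)
        show "\<Union> (blk S g ` S) = X" using S g by (auto simp: blk_def)
        show "disjnt p q" if "p \<in> blk S g ` S" "q \<in> blk S g ` S" "p \<noteq> q" for p q
          using that by (auto simp: blk_def disjnt_def)
        show "{} \<notin> blk S g ` S" by (auto simp: blk_def)
      qed
      moreover have "card (blk S g ` S) = s" using inj S by (simp add: card_image)
      moreover have "(\<lambda>B\<in>blk S g ` S. (THE t. t \<in> S \<and> t \<in> B)) \<in> PiE (blk S g ` S) (\<lambda>B. B)"
      proof (rule restrict_PiE_iff[THEN iffD2], rule ballI)
        fix B assume "B \<in> blk S g ` S"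
        then obtain t where t: "t \<in> S" "B = blk S g t" by auto
        then have "(THE t'. t' \<in> S \<and> t' \<in> B) = t"
          by (intro the_equality) (auto simp: blk_def)
        then show "(THE t. t \<in> S \<and> t \<in> B) \<in> B" using t by (simp add: blk_def)
      qed
      ultimately show "y \<in> ?L" by (simp add: y G_def)
    qed
  qed
  have "(\<Sum>P\<in>?Ps. \<Prod>B\<in>P. card B) = (\<Sum>P\<in>?Ps. card (PiE P (\<lambda>B. B)))"
    by (intro sum.cong refl) (simp add: card_PiE finP)
  also have "\<dots> = card ?L"
    by (rule card_SigmaI[symmetric]) (use finPs finP finB in \<open>auto intro!: finite_PiE\<close>)
  also have "\<dots> = card ?R" by (rule bij_betw_same_card[OF bij])
  also have "\<dots> = (\<Sum>S\<in>?Ss. card (PiE (X - S) (\<lambda>_. S)))"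
    using assms by (intro card_SigmaI) (auto intro!: finite_PiE intro: finite_subset)
  also have "\<dots> = (\<Sum>S\<in>?Ss. s ^ (card X - s))"
    using assms by (intro sum.cong refl) (auto simp: card_PiE card_Diff_subset finite_subset)
  also have "\<dots> = (card X choose s) * s ^ (card X - s)"
    using n_subsets[OF assms, of s] by simp
  finally show ?thesis .
qed

text \<open>Both partition posets turn out to have these Whitney numbers of the second and, up to sign,
  of the first kind.\<close>

definition W2 :: "nat \<Rightarrow> nat \<Rightarrow> nat" where
  "W2 n k = (n choose k) * (n - k) ^ k"

definition W1 :: "nat \<Rightarrow> nat \<Rightarrow> nat" where
  "W1 n k = (n - 1 choose k) * n ^ k"

text \<open>After multiplication by \<open>s = n - m\<close> the binomial coefficients factor so
  that \<open>m choose k\<close> appears, and the sum becomes a combination of the binomial theorem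
  and its derivative, evaluated where the two contributions cancel.\<close>

lemma W1_W2_orthogonal:
  assumes "0 < m" "m < n"
  shows "(\<Sum>k\<le>m. (- 1) ^ k * int (W1 n k) * int ((n - k choose (n - m)) * (n - m) ^ (m - k))) = 0"
proof -
  define s where "s = n - m"
  have s: "0 < s" "n = s + m" using assms by (auto simp: s_def)
  have key: "int s * (int (n - 1 choose k) * int (n - k choose s))
      = int (n - 1 choose (s - 1)) * (int (m choose k) * int (n - k))" if "k \<le> m" for k
  proof -
    have "s * (n - k choose s) = (n - k) * (n - k - 1 choose (s - 1))"
      using binomial_absorption[of "s - 1" "n - k"] s by simp
    moreover have "(n - 1 choose k) * (n - k - 1 choose (s - 1)) = (n - 1 choose (s - 1)) * (m choose k)"
    proof -
      have "(n - 1 choose (s - 1 + k)) * ((s - 1 + k) choose k) = (n - 1 choose k) * ((n - 1 - k) choose (s - 1 + k - k))"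
        by (rule choose_mult) (use that s in auto)
      moreover have "(n - 1 choose (s - 1 + k)) * ((s - 1 + k) choose (s - 1)) = (n - 1 choose (s - 1)) * ((n - 1 - (s - 1)) choose (s - 1 + k - (s - 1)))"
        by (rule choose_mult) (use that s in auto)
      moreover have "((s - 1 + k) choose k) = ((s - 1 + k) choose (s - 1))"
        using binomial_symmetric[of k "s - 1 + k"] by simp
      moreover have "n - 1 - (s - 1) = m" using s by auto
      moreover have "n - 1 - k = n - k - 1" by simp
      ultimately show ?thesis by simp
    qed
    moreover have "s * (A * B) = D * (M * E)" if "s * B = E * B'" "A * B' = D * M" for A B D M E B' :: nat
    proof -
      have "s * (A * B) = A * (E * B')" using that(1) by (metis mult.left_commute)
      also have "\<dots> = E * (D * M)" using that(2) by (metis mult.left_commute)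
      finally show ?thesis by simp
    qed
    ultimately have "s * ((n - 1 choose k) * (n - k choose s)) = (n - 1 choose (s - 1)) * ((m choose k) * (n - k))"
      by blast
    then show ?thesis unfolding of_nat_mult[symmetric] by (rule arg_cong)
  qed
  \<comment> \<open>With \<open>y = - int n\<close> the signs and the powers of \<open>n\<close>
    merge into \<open>y ^ k\<close>, and \<open>y + s = - m\<close> makes the final expression
    vanish.\<close>
  define y where "y = - int n"
  have b1: "(\<Sum>k\<le>m. int (m choose k) * y ^ k * int s ^ (m - k)) = (y + int s) ^ m"
    by (simp add: binomial_ring)
  \<comment> \<open>This is \<open>y\<close> times the derivative of the binomial theorem in
    \<open>y\<close>; it accounts for the summand \<open>- k\<close> of the factor
    \<open>n - k\<close>.\<close>
  have b2: "(\<Sum>k\<le>m. int (m choose k) * int k * y ^ k * int s ^ (m - k)) = int m * y * (y + int s) ^ (m - 1)"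
  proof -
    obtain m' where m': "m = Suc m'" using assms by (cases m) auto
    have "(\<Sum>k\<le>m. int (m choose k) * int k * y ^ k * int s ^ (m - k))
      = (\<Sum>k\<le>m'. int (Suc m' choose Suc k) * int (Suc k) * y ^ Suc k * int s ^ (m' - k))"
      unfolding m' by (subst sum.atMost_Suc_shift) simp
    also have "\<dots> = (\<Sum>k\<le>m'. int m * y * (int (m' choose k) * y ^ k * int s ^ (m' - k)))"
    proof (intro sum.cong refl)
      fix k
      have "int (Suc m' choose Suc k) * int (Suc k) = int m * int (m' choose k)"
        using arg_cong[OF binomial_absorption[of k "Suc m'"], of int] unfolding m' of_nat_mult
        by (simp only: mult.commute diff_Suc_1)
      then show "int (Suc m' choose Suc k) * int (Suc k) * y ^ Suc k * int s ^ (m' - k)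
         = int m * y * (int (m' choose k) * y ^ k * int s ^ (m' - k))"
        by (simp add: algebra_simps)
    qed
    also have "\<dots> = int m * y * (y + int s) ^ m'"
      by (simp add: binomial_ring sum_distrib_left)
    finally show ?thesis by (simp add: m')
  qed
  have "int s * (\<Sum>k\<le>m. (- 1) ^ k * int (W1 n k) * int ((n - k choose (n - m)) * (n - m) ^ (m - k)))
     = (\<Sum>k\<le>m. int (n - 1 choose (s - 1)) * (int n * (int (m choose k) * y ^ k * int s ^ (m - k))
           - int (m choose k) * int k * y ^ k * int s ^ (m - k)))"
    unfolding sum_distrib_left
  proof (intro sum.cong refl)
    fix k assume "k \<in> {..m}"
    then have k: "k \<le> m" by simp
    have yk: "y ^ k = (- 1) ^ k * int n ^ k" unfolding y_def by (metis power_minus)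
    have ink: "int (n - k) = int n - int k" using k s by auto
    have "int s * ((- 1) ^ k * int (W1 n k) * int ((n - k choose (n - m)) * (n - m) ^ (m - k)))
      = (int s * (int (n - 1 choose k) * int (n - k choose s))) * y ^ k * int s ^ (m - k)"
      by (simp add: W1_def s_def[symmetric] yk algebra_simps)
    also have "\<dots> = int (n - 1 choose (s - 1)) * (int (m choose k) * int (n - k)) * y ^ k * int s ^ (m - k)"
      by (simp only: key[OF k])
    also have "\<dots> = int (n - 1 choose (s - 1)) * (int n * (int (m choose k) * y ^ k * int s ^ (m - k))
           - int (m choose k) * int k * y ^ k * int s ^ (m - k))"
      unfolding ink by (simp add: algebra_simps)
    finally show "int s * ((- 1) ^ k * int (W1 n k) * int ((n - k choose (n - m)) * (n - m) ^ (m - k)))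
      = \<dots>" .
  qed
  also have "\<dots> = int (n - 1 choose (s - 1)) * (int n * (y + int s) ^ m - int m * y * (y + int s) ^ (m - 1))"
    by (simp add: sum_distrib_left[symmetric] sum_subtractf b1 b2)
  also have "\<dots> = 0"
  proof -
    obtain m' where m': "m = Suc m'" using assms by (cases m) auto
    have ys: "y + int s = - int m" using s by (simp add: y_def)
    show ?thesis unfolding ys by (simp add: m' y_def algebra_simps)
  qed
  finally show ?thesis using s by simp
qed

lemma W2_0 [simp]: "W2 n 0 = 1" and W1_0 [simp]: "W1 n 0 = 1"
  and W1_1: "W1 n (Suc 0) = n * (n - 1)" and W2_1: "W2 n (Suc 0) = n * (n - 1)"
  by (simp_all add: W1_def W2_def)

lemma W1_eq_0: "n \<le> k \<Longrightarrow> 0 < n \<Longrightarrow> W1 n k = 0"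
  by (simp add: W1_def)

lemma W2_eq_0: "n \<le> k \<Longrightarrow> 0 < n \<Longrightarrow> W2 n k = 0"
  by (cases "k = n") (auto simp: W2_def)

text \<open>Multiplied by \<open>c = n - j\<close>, all three terms become multiples of
  \<open>B = (n - 1 choose j)\<close> by absorption. The bound
  \<open>c ^ i <= n ^ (i - 1) * c\<close> needs \<open>1 <= i\<close>, that is
  \<open>2 <= j\<close>.\<close>

lemma W1_W2_gap:
  assumes "2 \<le> j" "j < n"
  shows "W1 n (j - 1) + W2 n j \<le> W1 n j"
proof -
  define c where "c = n - j"
  obtain i where i: "j = Suc i" "1 \<le> i" using assms by (cases j) auto
  have c: "1 \<le> c" "n = c + j" using assms by (auto simp: c_def)
  define B where "B = n - 1 choose j"
  have cB: "c * (n choose j) = n * B"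
    unfolding c_def B_def using assms
    using binomial_absorb_comp[of n j] by simp
  have cj: "c * (n - 1 choose i) = j * B"
  proof -
    have "Suc i * ((n - 1) choose Suc i) = (n - 1 - i) * (n - 1 choose i)"
      using binomial_absorb_comp[of "n - 1" i] binomial_absorption[of i "n - 1"] by simp
    then show ?thesis using i c by (simp add: B_def)
  qed
  have ci: "c ^ i \<le> n ^ (i - 1) * c"
  proof -
    have "c ^ (i - 1) \<le> n ^ (i - 1)" using c by (intro power_mono) auto
    moreover have "c ^ i = c ^ (i - 1) * c" using i by (cases i) auto
    ultimately show ?thesis by simp
  qed
  have "c * (W1 n i + W2 n j) = j * B * n ^ i + n * B * (c * c ^ i)"
  proof -
    have "c * (W1 n i + W2 n j) = (c * (n - 1 choose i)) * n ^ i + (c * (n choose j)) * c ^ j"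
      by (simp add: W1_def W2_def c_def[symmetric] algebra_simps)
    then show ?thesis unfolding cB cj by (simp add: i(1))
  qed
  also have "\<dots> \<le> j * B * n ^ i + n * B * (c * (n ^ (i - 1) * c))"
    using ci by (simp add: mult_le_mono)
  also have "n * B * (c * (n ^ (i - 1) * c)) = B * c * c * n ^ i"
    using i by (cases i) (auto simp: algebra_simps)
  also have "j * B * n ^ i + B * c * c * n ^ i = (j + c * c) * (B * n ^ i)"
    by (simp add: algebra_simps)
  \<comment> \<open>Since \<open>n = c + j\<close> and \<open>1 <= c\<close>, the product
    \<open>c * n = c * c + c * j\<close> is at least \<open>c * c + j\<close>.\<close>
  also have "\<dots> \<le> (c * n) * (B * n ^ i)"
    using c by (intro mult_le_mono) (auto simp: algebra_simps)
  also have "\<dots> = c * W1 n j"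
    by (simp add: W1_def B_def i(1))
  finally have "W1 n i + W2 n j \<le> W1 n j" using c by simp
  then show ?thesis using i by simp
qed

lemma binomial_ge_top: "0 < k \<Longrightarrow> k < n \<Longrightarrow> n \<le> n choose k"
proof (induction n arbitrary: k)
  case (Suc n)
  then obtain i where i: "k = Suc i" by (cases k) auto
  have "Suc n choose k = (n choose i) + (n choose Suc i)" using i by simp
  moreover have "0 < n choose i" using Suc.prems i by (intro zero_less_binomial) auto
  moreover have "n choose Suc i = 1" if "Suc i = n" using that by simp
  moreover have "n choose i = n" if "Suc i = n" using that by auto
  moreover have "n \<le> n choose Suc i" if "Suc i \<noteq> n" using Suc i that by auto
  ultimately show ?case using i by (cases "Suc i = n") linarith+
qed simp

text \<open>For \<open>4 <= n\<close> this puts the indices 0 to 3 of each layer between the bottom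
  and the top rank below \<open>W2 n k\<close>, so the local change at the indices 2 and 3 stays
  among the elements with prescribed Moebius values.\<close>

lemma W2_ge:
  assumes "0 < k" "k < n"
  shows "n \<le> W2 n k"
proof -
  have "1 \<le> (n - k) ^ k" using assms by (intro one_le_power) simp
  then have "n * 1 \<le> (n choose k) * (n - k) ^ k"
    by (intro mult_le_mono binomial_ge_top assms)
  then show ?thesis by (simp add: W2_def)
qed

section \<open>Whitney numbers of the partition posets\<close>

lemma card_partition_le:
  assumes "finite X" "partition_on X P"
  shows "card P \<le> card X"
proof (rule card_inj_on_le)
  let ?f = "\<lambda>B. SOME x. x \<in> B"
  have f: "?f B \<in> B" if "B \<in> P" for B
    using that assms(2) by (auto simp: partition_on_def some_in_eq)
  show "inj_on ?f P"
  proof (rule inj_onI)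
    fix B B' assume B: "B \<in> P" "B' \<in> P" "?f B = ?f B'"
    then have "?f B \<in> B \<inter> B'" using f[of B] f[of B'] by simp
    then show "B = B'" using B assms(2) by (auto simp: partition_on_def disjoint_def)
  qed
  show "?f ` P \<subseteq> X"
    using f assms(2) by (auto simp: partition_on_def)
qed (rule assms(1))

text \<open>Common form of both covers: \<open>comb p q\<close> is \<open>{p, q}\<close> for pointed
  and \<open>{p + q, p + q + 1}\<close> for weighted partitions.\<close>

definition block_cover ::
  "(nat \<Rightarrow> nat \<Rightarrow> nat set) \<Rightarrow> (nat set \<times> nat) set \<Rightarrow> (nat set \<times> nat) set \<Rightarrow> bool" where
  "block_cover comb \<pi> \<pi>' \<longleftrightarrow>
     (\<exists>A p B q. (A, p) \<in> \<pi> \<and> (B, q) \<in> \<pi> \<and> (A, p) \<noteq> (B, q) \<and>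
        (\<exists>s\<in>comb p q. \<pi>' = insert (A \<union> B, s) (\<pi> - {(A, p), (B, q)})))"

text \<open>\<open>P\<close> is meant as a partition of the set of blocks, not of the ground set:
  each group of blocks becomes one block, decorated by \<open>h\<close>.\<close>

definition merge_blocks :: "((nat set \<times> nat) set \<Rightarrow> nat) \<Rightarrow> (nat set \<times> nat) set set \<Rightarrow> (nat set \<times> nat) set" where
  "merge_blocks h P = (\<lambda>G. (\<Union>(fst ` G), h G)) ` P"

text \<open>\<open>allowed G\<close> is the set of decorations that a block obtained by merging all the blocks in \<open>G\<close>
  can carry, and \<open>d i\<close> is the decoration of the block \<open>{i}\<close> in the minimum.\<close>

locale decorated =
  fixes n :: nat and dec :: "nat set \<Rightarrow> nat set" and comb :: "nat \<Rightarrow> nat \<Rightarrow> nat set"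
    and allowed :: "(nat set \<times> nat) set \<Rightarrow> nat set" and d :: "nat \<Rightarrow> nat"
  assumes n_pos: "0 < n"
    and finite_dec: "A \<subseteq> {1..n} \<Longrightarrow> finite (dec A)"
    and dec_comb: "A \<subseteq> {1..n} \<Longrightarrow> B \<subseteq> {1..n} \<Longrightarrow> A \<noteq> {} \<Longrightarrow> B \<noteq> {} \<Longrightarrow> A \<inter> B = {} \<Longrightarrow>
      p \<in> dec A \<Longrightarrow> q \<in> dec B \<Longrightarrow> s \<in> comb p q \<Longrightarrow> s \<in> dec (A \<union> B)"
    and comb_nonempty: "comb p q \<noteq> {}"
    and allowed_single: "allowed {g} = {snd g}"
    and allowed_Un: "finite G \<Longrightarrow> finite H \<Longrightarrow> G \<noteq> {} \<Longrightarrow> H \<noteq> {} \<Longrightarrow> G \<inter> H = {} \<Longrightarrow>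
      allowed (G \<union> H) = (\<Union>p\<in>allowed G. \<Union>q\<in>allowed H. comb p q)"
    and card_allowed: "x \<in> decorated_partitions dec n \<Longrightarrow> G \<subseteq> x \<Longrightarrow> G \<noteq> {} \<Longrightarrow> card (allowed G) = card G"
    and allowed_bottom: "A \<subseteq> {1..n} \<Longrightarrow> A \<noteq> {} \<Longrightarrow> allowed ((\<lambda>i. ({i}, d i)) ` A) = dec A"
begin

abbreviation "C \<equiv> decorated_partitions dec n"

lemma C_iff:
  "x \<in> C \<longleftrightarrow> (\<forall>g\<in>x. fst g \<noteq> {} \<and> snd g \<in> dec (fst g)) \<and>
     (\<forall>g\<in>x. \<forall>g'\<in>x. g \<noteq> g' \<longrightarrow> fst g \<inter> fst g' = {}) \<and> \<Union>(fst ` x) = {1..n}" (is "_ \<longleftrightarrow> ?R")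
proof
  assume x: "x \<in> C"
  then have inj: "inj_on fst x" and p: "partition_on {1..n} (fst ` x)" and dc: "\<forall>(A, v)\<in>x. v \<in> dec A"
    by (auto simp: decorated_partitions_def)
  have "fst g \<inter> fst g' = {}" if "g \<in> x" "g' \<in> x" "g \<noteq> g'" for g g'
  proof -
    have "fst g \<noteq> fst g'" using inj that by (auto simp: inj_on_def)
    then show ?thesis using p that by (auto simp: partition_on_def disjoint_def)
  qed
  moreover have "fst g \<noteq> {} \<and> snd g \<in> dec (fst g)" if "g \<in> x" for g
    using p dc that by (auto simp: partition_on_def)
  moreover have "\<Union>(fst ` x) = {1..n}" using p by (auto simp: partition_on_def)
  ultimately show ?R by simp
next
  assume R: ?R
  have "inj_on fst x"
    by (rule inj_onI) (use R in \<open>metis Int_absorb\<close>)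
  moreover have "partition_on {1..n} (fst ` x)"
  proof (rule partition_onI)
    show "\<Union> (fst ` x) = {1..n}" using R by simp
    show "disjnt p q" if pq: "p \<in> fst ` x" "q \<in> fst ` x" "p \<noteq> q" for p q
    proof -
      obtain g g' where "g \<in> x" "g' \<in> x" "p = fst g" "q = fst g'"
        using pq unfolding image_iff by blast
      then show ?thesis using R pq(3) unfolding disjnt_def by metis
    qed
    show "{} \<notin> fst ` x" using R by auto
  qed
  moreover have "\<forall>(A, v)\<in>x. v \<in> dec A" using R by auto
  ultimately show "x \<in> C" by (simp add: decorated_partitions_def)
qed

lemma C_block: "x \<in> C \<Longrightarrow> g \<in> x \<Longrightarrow> fst g \<noteq> {} \<and> fst g \<subseteq> {1..n} \<and> snd g \<in> dec (fst g)"
  unfolding C_iff by auto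

lemma C_disjoint: "x \<in> C \<Longrightarrow> g \<in> x \<Longrightarrow> g' \<in> x \<Longrightarrow> g \<noteq> g' \<Longrightarrow> fst g \<inter> fst g' = {}"
  unfolding C_iff by simp

lemma finite_block_set: "x \<in> C \<Longrightarrow> finite x"
  and card_le: "x \<in> C \<Longrightarrow> card x \<le> n"
  and card_pos: "x \<in> C \<Longrightarrow> 0 < card x"
proof -
  assume x: "x \<in> C"
  then have inj: "inj_on fst x" and p: "partition_on {1..n} (fst ` x)"
    by (auto simp: decorated_partitions_def)
  have "finite (fst ` x)" using p by (rule finite_elements[rotated]) simp
  then show fin: "finite x" using inj by (simp add: finite_image_iff)
  show "card x \<le> n" using card_partition_le[OF _ p] card_image[OF inj] by simp
  have "x \<noteq> {}" using x n_pos by (auto simp: C_iff)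
  then show "0 < card x" using fin by (simp add: card_gt_0_iff)
qed

lemma finite_C: "finite C"
proof (rule finite_subset)
  show "C \<subseteq> Pow (Sigma (Pow {1..n}) dec)"
    using C_block by fastforce
  show "finite (Pow (Sigma (Pow {1..n}) dec))"
    using finite_dec by (intro finite_Pow_iff[THEN iffD2] finite_SigmaI) auto
qed

lemma step_C:
  assumes "x \<in> C" "block_cover comb x y"
  shows "y \<in> C" "Suc (card y) = card x"
proof -
  obtain A p B q s where ab: "(A, p) \<in> x" "(B, q) \<in> x" "(A, p) \<noteq> (B, q)" "s \<in> comb p q"
    and y: "y = insert (A \<union> B, s) (x - {(A, p), (B, q)})"
    using assms(2) unfolding block_cover_def by blast
  have AB: "A \<inter> B = {}" using C_disjoint[OF assms(1) ab(1-3)] by simp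
  have bA: "A \<noteq> {}" "A \<subseteq> {1..n}" "p \<in> dec A" using C_block[OF assms(1) ab(1)] by auto
  have bB: "B \<noteq> {}" "B \<subseteq> {1..n}" "q \<in> dec B" using C_block[OF assms(1) ab(2)] by auto
  have rest: "fst g \<inter> (A \<union> B) = {}" if "g \<in> x - {(A, p), (B, q)}" for g
    using C_disjoint[OF assms(1), of g "(A, p)"] C_disjoint[OF assms(1), of g "(B, q)"] that ab by auto
  have x: "x = insert (A, p) (insert (B, q) (x - {(A, p), (B, q)}))" using ab by auto
  have "\<Union>(fst ` y) = \<Union>(fst ` x)"
    by (subst x) (auto simp: y)
  then have "\<Union>(fst ` y) = {1..n}" using assms(1) by (simp add: C_iff)
  moreover have "s \<in> dec (A \<union> B)" using dec_comb bA bB AB ab(4) by blast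
  moreover have "fst g \<inter> fst g' = {}" if "g \<in> y" "g' \<in> y" "g \<noteq> g'" for g g'
    using that rest[of g] rest[of g'] C_disjoint[OF assms(1), of g g'] unfolding y by auto
  moreover have "fst g \<noteq> {} \<and> snd g \<in> dec (fst g)" if "g \<in> y" for g
    using that C_block[OF assms(1), of g] bA \<open>s \<in> dec (A \<union> B)\<close> unfolding y by auto
  ultimately show "y \<in> C" unfolding C_iff by simp
  have fin: "finite x" by (rule finite_block_set[OF assms(1)])
  have "(A \<union> B, s) \<notin> x - {(A, p), (B, q)}" using rest[of "(A \<union> B, s)"] bA by auto
  then have "card y = Suc (card (x - {(A, p), (B, q)}))" using fin by (simp add: y)
  moreover have "card x = Suc (Suc (card (x - {(A, p), (B, q)})))"
    by (subst x) (use fin ab(3) in auto)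
  ultimately show "Suc (card y) = card x" by simp
qed

sublocale ranked_steps C "block_cover comb" "\<lambda>x. n - card x"
proof
  fix u v assume "u \<in> C" "v \<in> C" "block_cover comb u v"
  then have "Suc (card v) = card u" "card u \<le> n" using step_C card_le by auto
  then show "n - card v = Suc (n - card u)" by auto
qed

section \<open>Upper sets: coarsenings with a choice of decorations\<close>

lemma allowed_dec:
  assumes x: "x \<in> C" and G: "G \<subseteq> x" "G \<noteq> {}"
  shows "allowed G \<subseteq> dec (\<Union>(fst ` G))"
proof -
  have "finite G" using G finite_block_set[OF x] finite_subset by blast
  then show ?thesis using G(2,1)
  proof (induction rule: finite_ne_induct)
    case (singleton g)
    then show ?case using C_block[OF x, of g] by (simp add: allowed_single)
  next
    case (insert g F)
    have "allowed (insert g F) = (\<Union>q\<in>allowed F. comb (snd g) q)"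
      using allowed_Un[of "{g}" F] insert by (simp add: allowed_single)
    moreover have "comb (snd g) q \<subseteq> dec (fst g \<union> \<Union>(fst ` F))" if "q \<in> allowed F" for q
    proof
      fix s assume "s \<in> comb (snd g) q"
      then show "s \<in> dec (fst g \<union> \<Union>(fst ` F))"
      proof (rule dec_comb[rotated -1])
        show "q \<in> dec (\<Union> (fst ` F))" using insert that by auto
        show "fst g \<inter> \<Union> (fst ` F) = {}"
          using C_disjoint[OF x, of g] insert.prems insert.hyps by fastforce
        show "\<Union> (fst ` F) \<noteq> {}" "\<Union> (fst ` F) \<subseteq> {1..n}"
          using C_block[OF x] insert.prems insert.hyps by fastforce+
        show "fst g \<subseteq> {1..n}" "fst g \<noteq> {}" "snd g \<in> dec (fst g)"
          using C_block[OF x, of g] insert.prems by auto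
      qed
    qed
    ultimately show ?case by auto
  qed
qed

lemma merge_blocks_inter:
  assumes x: "x \<in> C" and G: "G \<subseteq> x" "G' \<subseteq> x" "G \<inter> G' = {}"
  shows "\<Union>(fst ` G) \<inter> \<Union>(fst ` G') = {}"
  using C_disjoint[OF x] G by (fastforce simp: subset_iff)

lemma merge_blocks_union_inj:
  assumes x: "x \<in> C" and G: "G \<subseteq> x" "G' \<subseteq> x" and eq: "\<Union>(fst ` G) = \<Union>(fst ` G')"
  shows "G = G'"
proof -
  have "H \<subseteq> H'" if H: "H \<subseteq> x" "H' \<subseteq> x" "\<Union>(fst ` H) = \<Union>(fst ` H')" for H H'
  proof
    fix g assume g: "g \<in> H"
    then obtain i where "i \<in> fst g" using C_block[OF x, of g] H by auto
    then obtain g' where g': "g' \<in> H'" "i \<in> fst g'" using H(3) g by blast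
    then have "g = g'" using C_disjoint[OF x, of g g'] g H \<open>i \<in> fst g\<close> by blast
    then show "g \<in> H'" using g' by simp
  qed
  then show ?thesis using G eq by (metis subset_antisym)
qed

lemma partition_subset: "partition_on x P \<Longrightarrow> G \<in> P \<Longrightarrow> G \<subseteq> x \<and> G \<noteq> {}"
  by (auto simp: partition_on_def)

lemma partition_disjoint: "partition_on x P \<Longrightarrow> G \<in> P \<Longrightarrow> G' \<in> P \<Longrightarrow> G \<noteq> G' \<Longrightarrow> G \<inter> G' = {}"
  by (auto simp: partition_on_def disjoint_def)

lemma merge_blocks_inj_on:
  assumes "x \<in> C" "partition_on x P"
  shows "inj_on (\<lambda>G. (\<Union>(fst ` G), h G)) P"
  using merge_blocks_union_inj[OF assms(1)] partition_subset[OF assms(2)]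
  by (intro inj_onI) (metis prod.inject)

lemma card_merge_blocks: "x \<in> C \<Longrightarrow> partition_on x P \<Longrightarrow> card (merge_blocks h P) = card P"
  unfolding merge_blocks_def by (intro card_image merge_blocks_inj_on)

lemma merge_blocks_C:
  assumes x: "x \<in> C" and P: "partition_on x P" and h: "h \<in> Pi P allowed"
  shows "merge_blocks h P \<in> C"
proof -
  have "\<Union>(fst ` merge_blocks h P) = \<Union>(fst ` \<Union>P)" by (auto simp: merge_blocks_def)
  also have "\<Union>P = x" using P by (auto simp: partition_on_def)
  also have "\<Union>(fst ` x) = {1..n}" using x by (simp add: C_iff)
  finally have 1: "\<Union>(fst ` merge_blocks h P) = {1..n}" .
  have 2: "fst g \<noteq> {} \<and> snd g \<in> dec (fst g)" if g: "g \<in> merge_blocks h P" for g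
  proof -
    obtain G where G: "G \<in> P" "g = (\<Union>(fst ` G), h G)" using g by (auto simp: merge_blocks_def)
    have sub: "G \<subseteq> x" "G \<noteq> {}" using partition_subset[OF P G(1)] by auto
    then have "\<Union>(fst ` G) \<noteq> {}" using C_block[OF x] by fastforce
    moreover have "h G \<in> dec (\<Union>(fst ` G))" using allowed_dec[OF x sub] h G by auto
    ultimately show ?thesis using G by simp
  qed
  have 3: "fst g \<inter> fst g' = {}"
    if g: "g \<in> merge_blocks h P" "g' \<in> merge_blocks h P" "g \<noteq> g'" for g g'
  proof -
    obtain G G' where G: "G \<in> P" "g = (\<Union>(fst ` G), h G)" "G' \<in> P" "g' = (\<Union>(fst ` G'), h G')"
      using g by (auto simp: merge_blocks_def)
    then have "G \<inter> G' = {}" using partition_disjoint[OF P] g(3) by blast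
    then have "\<Union>(fst ` G) \<inter> \<Union>(fst ` G') = {}"
      by (intro merge_blocks_inter[OF x]) (use partition_subset[OF P] G in auto)
    then show ?thesis using G by simp
  qed
  show ?thesis unfolding C_iff using 1 2 3 by simp
qed

text \<open>Each cover joins two groups \<open>G1\<close> and \<open>G2\<close> of original blocks;
  by \<open>allowed_Un\<close> the combined decoration is allowed for their union.\<close>

lemma ord_merge_blocks:
  assumes "(x, z) \<in> ord"
  shows "\<exists>P h. partition_on x P \<and> h \<in> Pi P allowed \<and> z = merge_blocks h P"
proof -
  have x: "x \<in> C" using assms ord_carrier by auto
  show ?thesis using assms
  proof (induction rule: ord_induct)
    case refl
    have "partition_on x ((\<lambda>g. {g}) ` x)"
      by (rule partition_onI) (auto simp: disjnt_def)
    moreover have "(\<lambda>G. snd (the_elem G)) \<in> Pi ((\<lambda>g. {g}) ` x) allowed"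
      by (auto simp: allowed_single)
    moreover have "x = merge_blocks (\<lambda>G. snd (the_elem G)) ((\<lambda>g. {g}) ` x)"
      by (simp add: merge_blocks_def image_image)
    ultimately show ?case by blast
  next
    case (step u v)
    then obtain P h where P: "partition_on x P" and h: "h \<in> Pi P allowed" and u: "u = merge_blocks h P"
      by blast
    obtain A p B q s where ab: "(A, p) \<in> u" "(B, q) \<in> u" "(A, p) \<noteq> (B, q)" "s \<in> comb p q"
      and v: "v = insert (A \<union> B, s) (u - {(A, p), (B, q)})"
      using \<open>block_cover comb u v\<close> unfolding block_cover_def by blast
    obtain G1 where G1: "G1 \<in> P" "A = \<Union>(fst ` G1)" "p = h G1" using ab(1) u by (auto simp: merge_blocks_def)
    obtain G2 where G2: "G2 \<in> P" "B = \<Union>(fst ` G2)" "q = h G2" using ab(2) u by (auto simp: merge_blocks_def)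
    have ne: "G1 \<noteq> G2" using ab(3) G1 G2 by auto
    have s1: "G1 \<subseteq> x" "G1 \<noteq> {}" "G2 \<subseteq> x" "G2 \<noteq> {}"
      using partition_subset[OF P G1(1)] partition_subset[OF P G2(1)] by auto
    have dj: "G1 \<inter> G2 = {}" using partition_disjoint[OF P G1(1) G2(1) ne] .
    \<comment> \<open>The union is not one of the remaining groups, so changing \<open>h\<close>
      there leaves their decorations alone.\<close>
    have new: "G1 \<union> G2 \<notin> P - {G1, G2}"
      using partition_disjoint[OF P G1(1), of "G1 \<union> G2"] s1 by auto
    let ?P = "insert (G1 \<union> G2) (P - {G1, G2})" and ?h = "h(G1 \<union> G2 := s)"
    have "partition_on x ?P"
    proof (rule partition_onI)
      have "\<Union>?P = \<Union>P" using G1(1) G2(1) by auto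
      then show "\<Union>?P = x" using P by (auto simp: partition_on_def)
      show "disjnt a b" if "a \<in> ?P" "b \<in> ?P" "a \<noteq> b" for a b
        using that partition_disjoint[OF P] G1(1) G2(1) unfolding disjnt_def by blast
      show "{} \<notin> ?P" using P s1 by (auto simp: partition_on_def)
    qed
    moreover have "?h \<in> Pi ?P allowed"
    proof
      fix G assume G: "G \<in> ?P"
      show "?h G \<in> allowed G"
      proof (cases "G = G1 \<union> G2")
        case True
        have "finite G1" "finite G2" using s1 finite_block_set[OF x] finite_subset by auto
        moreover have "h G1 \<in> allowed G1" "h G2 \<in> allowed G2" using h G1(1) G2(1) by auto
        ultimately show ?thesis using True allowed_Un[of G1 G2] s1 dj ab(4) G1(3) G2(3) by auto
      next
        case False
        then show ?thesis using G h by auto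
      qed
    qed
    moreover have "v = merge_blocks ?h ?P"
    proof -
      have "merge_blocks ?h (P - {G1, G2}) = merge_blocks h (P - {G1, G2})"
        unfolding merge_blocks_def by (rule image_cong[OF refl]) (use new in auto)
      moreover have "merge_blocks ?h ?P = insert (A \<union> B, s) (merge_blocks ?h (P - {G1, G2}))"
        unfolding merge_blocks_def image_insert by (simp only: image_Un Union_Un_distrib G1(2) G2(2) fun_upd_same)
      ultimately have "merge_blocks ?h ?P = insert (A \<union> B, s) (merge_blocks h (P - {G1, G2}))" by simp
      moreover have "merge_blocks h (P - {G1, G2}) = u - {(A, p), (B, q)}"
        using inj_on_image_set_diff[OF merge_blocks_inj_on[OF x P, of h], of P "{G1, G2}"] G1 G2
        by (simp add: u merge_blocks_def)
      ultimately show ?thesis by (simp add: v)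
    qed
    ultimately show ?case by blast
  qed
qed

text \<open>A group with more than one block is split into a single block and the rest. The finer
  grouping is reached by induction, and one further cover joins the two parts again. With singleton
  groups only, nothing has been merged.\<close>

lemma merge_blocks_ord:
  assumes x: "x \<in> C" and P: "partition_on x P" and h: "h \<in> Pi P allowed"
  shows "(x, merge_blocks h P) \<in> ord"
  using P h
proof (induction "card x - card P" arbitrary: P h rule: less_induct)
  case less
  note P = less.prems(1) and h = less.prems(2)
  have finx: "finite x" by (rule finite_block_set[OF x])
  have finP: "finite P" using P finx by (rule finite_elements[rotated])
  show ?case
  proof (cases "\<forall>G\<in>P. \<exists>g. G = {g}")
    case True
    have "P = (\<lambda>g. {g}) ` x"
    proof
      show "P \<subseteq> (\<lambda>g. {g}) ` x"
      proof
        fix G assume G: "G \<in> P"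
        then obtain g where "G = {g}" using True by metis
        then show "G \<in> (\<lambda>g. {g}) ` x" using partition_subset[OF P G] by simp
      qed
      show "(\<lambda>g. {g}) ` x \<subseteq> P"
      proof
        fix G assume "G \<in> (\<lambda>g. {g}) ` x"
        then obtain g where g: "g \<in> x" "G = {g}" by auto
        then obtain H where H: "H \<in> P" "g \<in> H" using P by (auto simp: partition_on_def)
        then obtain g' where "H = {g'}" using True by metis
        then show "G \<in> P" using H g by simp
      qed
    qed
    moreover have "h {g} = snd g" if "g \<in> x" for g
      using h that calculation allowed_single[of g] by (metis Pi_mem imageI singletonD)
    ultimately have "merge_blocks h P = x" by (simp add: merge_blocks_def image_image)
    then show ?thesis using ord_refl[OF x] by simp
  next
    case False
    then obtain G where G: "G \<in> P" "\<And>g. G \<noteq> {g}" by metis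
    have Gx: "G \<subseteq> x" "G \<noteq> {}" using partition_subset[OF P G(1)] by auto
    then obtain g where g: "g \<in> G" by auto
    define G' where "G' = G - {g}"
    have G': "G = insert g G'" "g \<notin> G'" "G' \<noteq> {}" "finite G'"
      using g G(2)[of g] Gx finx finite_subset by (auto simp: G'_def)
    have "h G \<in> allowed ({g} \<union> G')" using h G G' by auto
    also have "allowed ({g} \<union> G') = (\<Union>q\<in>allowed G'. comb (snd g) q)"
      using allowed_Un[of "{g}" G'] G' by (simp add: allowed_single)
    \<comment> \<open>\<open>allowed_Un\<close> read backwards: some allowed decoration
      \<open>q\<close> of the rest combines with that of \<open>g\<close> to the prescribed
      \<open>h G\<close>.\<close>
    finally obtain q where q: "q \<in> allowed G'" "h G \<in> comb (snd g) q" by auto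
    let ?R = "P - {G}"
    have dis: "G \<inter> H = {}" if "H \<in> ?R" for H using partition_disjoint[OF P G(1)] that by auto
    have new: "{g} \<notin> ?R" "G' \<notin> ?R" using dis[of "{g}"] dis[of G'] G' by auto
    have ne: "{g} \<noteq> G'" using G' by auto
    define P' where "P' = insert {g} (insert G' ?R)"
    define h' where "h' = h({g} := snd g, G' := q)"
    have sub: "g \<in> G" "G' \<subseteq> G" "g \<notin> G'" using G' by auto
    have P': "partition_on x P'"
    proof (rule partition_onI)
      have "\<Union>P' = \<Union>P" using G G' by (auto simp: P'_def)
      then show "\<Union>P' = x" using P by (auto simp: partition_on_def)
      show "disjnt a b" if "a \<in> P'" "b \<in> P'" "a \<noteq> b" for a b
      proof -
        have "a \<in> ?R \<Longrightarrow> b \<in> ?R \<Longrightarrow> a \<inter> b = {}" using partition_disjoint[OF P, of a b] that(3) by auto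
        moreover have "a \<in> ?R \<Longrightarrow> G \<inter> a = {}" "b \<in> ?R \<Longrightarrow> G \<inter> b = {}" using dis by auto
        moreover have "a = {g} \<or> a = G' \<or> a \<in> ?R" "b = {g} \<or> b = G' \<or> b \<in> ?R"
          using that(1,2) by (auto simp: P'_def)
        ultimately show ?thesis using sub that(3) unfolding disjnt_def by (elim disjE) blast+
      qed
      show "{} \<notin> P'" using P G' by (auto simp: partition_on_def P'_def)
    qed
    have h': "h' \<in> Pi P' allowed"
    proof
      fix H assume "H \<in> P'"
      then consider "H = {g}" | "H = G'" | "H \<in> ?R" by (auto simp: P'_def)
      then show "h' H \<in> allowed H"
      proof cases
        case 1
        then show ?thesis using ne allowed_single[of g] by (simp add: h'_def)
      next
        case 2
        then show ?thesis using q by (simp add: h'_def)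
      next
        case 3
        then have "h' H = h H" using new by (auto simp: h'_def)
        then show ?thesis using h 3 by auto
      qed
    qed
    have "card P' = Suc (Suc (card ?R))" using new ne finP by (simp add: P'_def)
    moreover have "card P = Suc (card ?R)" using G finP by (metis card.remove)
    ultimately have "card P' = Suc (card P)" by simp
    then have "card x - card P' < card x - card P"
      using card_partition_le[OF finx P'] by linarith
    then have ord': "(x, merge_blocks h' P') \<in> ord"
      by (rule less.hyps[OF _ P' h'])
    have img: "merge_blocks h' ?R = merge_blocks h ?R"
      unfolding merge_blocks_def by (rule image_cong[OF refl]) (use new in \<open>simp add: h'_def, blast\<close>)
    have u: "merge_blocks h' P' = insert g (insert (\<Union>(fst ` G'), q) (merge_blocks h ?R))"
    proof -
      have "merge_blocks h' P' = insert (\<Union>(fst ` {g}), h' {g}) (insert (\<Union>(fst ` G'), h' G') (merge_blocks h' ?R))"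
        by (simp only: merge_blocks_def P'_def image_insert)
      moreover have "h' {g} = snd g" "h' G' = q" using ne by (simp_all add: h'_def)
      ultimately show ?thesis using img by simp
    qed
    have v: "merge_blocks h P = insert (fst g \<union> \<Union>(fst ` G'), h G) (merge_blocks h ?R)"
    proof -
      have "P = insert G ?R" using G by auto
      then have "merge_blocks h P = insert (\<Union>(fst ` G), h G) (merge_blocks h ?R)"
        unfolding merge_blocks_def by (metis (no_types, lifting) image_insert)
      moreover have "\<Union>(fst ` G) = fst g \<union> \<Union>(fst ` G')" by (subst G'(1)) simp
      ultimately show ?thesis by simp
    qed
    have nonin: "b \<notin> merge_blocks h ?R" if "fst b \<subseteq> \<Union>(fst ` G)" "fst b \<noteq> {}" for b
    proof
      assume "b \<in> merge_blocks h ?R"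
      then obtain H where "b = (\<Union>(fst ` H), h H)" and HR: "H \<in> ?R"
        unfolding merge_blocks_def by (rule imageE)
      then have H: "fst b = \<Union>(fst ` H)" by simp
      then have "\<Union>(fst ` G) \<inter> \<Union>(fst ` H) = {}"
        using merge_blocks_inter[OF x Gx(1), of H] dis[OF HR] partition_subset[OF P, of H] HR by blast
      then show False using that H by blast
    qed
    have fG': "\<Union>(fst ` G') \<noteq> {}"
    proof -
      obtain g' where g': "g' \<in> G'" using G'(3) by blast
      then have "g' \<in> x" using sub Gx by blast
      then show ?thesis using C_block[OF x, of g'] g' by auto
    qed
    have nong: "g \<notin> merge_blocks h ?R"
      by (rule nonin) (use g C_block[OF x, of g] Gx in blast)+
    have nonG': "(\<Union>(fst ` G'), q) \<notin> merge_blocks h ?R"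
    proof (rule nonin)
      show "fst (\<Union>(fst ` G'), q) \<subseteq> \<Union>(fst ` G)" using sub by auto
    qed (use fG' in simp)
    have neg: "(fst g, snd g) \<noteq> (\<Union>(fst ` G'), q)"
    proof -
      have "\<Union>(fst ` {g}) \<inter> \<Union>(fst ` G') = {}"
        by (rule merge_blocks_inter[OF x]) (use sub Gx in blast)+
      then have "fst g \<inter> \<Union>(fst ` G') = {}" by simp
      then show ?thesis using fG' by (metis Int_absorb prod.inject)
    qed
    have "block_cover comb (merge_blocks h' P') (merge_blocks h P)"
      unfolding block_cover_def
    proof (intro exI conjI bexI)
      show "(fst g, snd g) \<in> merge_blocks h' P'" "(\<Union>(fst ` G'), q) \<in> merge_blocks h' P'"
        by (simp_all add: u)
      show "(fst g, snd g) \<noteq> (\<Union>(fst ` G'), q)" by (rule neg)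
      show "h G \<in> comb (snd g) q" by (rule q)
      show "merge_blocks h P = insert (fst g \<union> \<Union> (fst ` G'), h G)
          (merge_blocks h' P' - {(fst g, snd g), (\<Union> (fst ` G'), q)})"
        unfolding u v using nong nonG' neg by auto
    qed
    then have "(merge_blocks h' P', merge_blocks h P) \<in> ord"
      using ord_step merge_blocks_C[OF x P h] merge_blocks_C[OF x P' h'] by simp
    then show ?thesis using ord' ord_trans by metis
  qed
qed

text \<open>An upper element determines the grouping \<open>P\<close> and the decorations
  \<open>h\<close>. As \<open>allowed G\<close> has \<open>card G\<close> elements, \<open>P\<close>
  contributes the product of the sizes of its groups, whatever the kind of decoration.\<close>

lemma card_above:
  assumes x: "x \<in> C"
  shows "card {z \<in> C. (x, z) \<in> ord \<and> card z = s} = (card x choose s) * s ^ (card x - s)"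
proof -
  have finx: "finite x" by (rule finite_block_set[OF x])
  let ?Ps = "{P. partition_on x P \<and> card P = s}"
  let ?S = "Sigma ?Ps (\<lambda>P. PiE P allowed)"
  let ?f = "\<lambda>(P, h). merge_blocks h P"
  have finPs: "finite ?Ps"
    by (rule finite_subset[of _ "Pow (Pow x)"]) (use finx in \<open>auto simp: partition_on_def\<close>)
  have finP: "finite P" if "partition_on x P" for P
    using that finx by (rule finite_elements[rotated])
  have cardG: "card (allowed G) = card G" "finite (allowed G)" if "partition_on x P" "G \<in> P" for P G
  proof -
    have G: "G \<subseteq> x" "G \<noteq> {}" using partition_subset[OF that] by auto
    show c: "card (allowed G) = card G" using card_allowed[OF x G] .
    have "finite G" using G finx finite_subset by blast
    then have "0 < card (allowed G)" using G c by (simp add: card_gt_0_iff)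
    then show "finite (allowed G)" by (rule card_ge_0_finite)
  qed
  have img: "{z \<in> C. (x, z) \<in> ord \<and> card z = s} = ?f ` ?S"
  proof
    show "{z \<in> C. (x, z) \<in> ord \<and> card z = s} \<subseteq> ?f ` ?S"
    proof
      fix z assume z: "z \<in> {z \<in> C. (x, z) \<in> ord \<and> card z = s}"
      then obtain P h where P: "partition_on x P" and h: "h \<in> Pi P allowed" and zP: "z = merge_blocks h P"
        using ord_merge_blocks by blast
      \<comment> \<open>Only the values of \<open>h\<close> on \<open>P\<close> matter; restricting
        it makes the pair unique.\<close>
      have "z = merge_blocks (restrict h P) P" unfolding zP merge_blocks_def by (intro image_cong) auto
      moreover have "card P = s" using z zP card_merge_blocks[OF x P] by simp
      moreover have "restrict h P \<in> PiE P allowed" using h by auto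
      ultimately show "z \<in> ?f ` ?S" using P by (intro image_eqI[of _ _ "(P, restrict h P)"]) auto
    qed
    show "?f ` ?S \<subseteq> {z \<in> C. (x, z) \<in> ord \<and> card z = s}"
      using merge_blocks_C[OF x] merge_blocks_ord[OF x] card_merge_blocks[OF x] by (auto simp: PiE_def)
  qed
  have inj: "inj_on ?f ?S"
  proof (rule inj_onI, clarify)
    fix P h P' h'
    assume P: "partition_on x P" and h: "h \<in> PiE P allowed" and P': "partition_on x P'"
      and h': "h' \<in> PiE P' allowed" and eq: "merge_blocks h P = merge_blocks h' P'"
    have sub: "G \<in> Q' \<and> k G = k' G"
      if "partition_on x Q" "partition_on x Q'" "merge_blocks k Q = merge_blocks k' Q'" "G \<in> Q" for Q Q' k k' G
    proof -
      have "(\<Union>(fst ` G), k G) \<in> merge_blocks k' Q'"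
        using that(3,4) unfolding merge_blocks_def by blast
      then obtain G' where "(\<Union>(fst ` G), k G) = (\<Union>(fst ` G'), k' G')" and "G' \<in> Q'"
        unfolding merge_blocks_def by (rule imageE)
      then have G': "G' \<in> Q'" "\<Union>(fst ` G) = \<Union>(fst ` G')" "k G = k' G'" by simp_all
      then have "G = G'"
        using merge_blocks_union_inj[OF x] partition_subset[OF that(1,4)] partition_subset[OF that(2) G'(1)] by blast
      then show ?thesis using G' by simp
    qed
    have PP: "P = P'" using sub[OF P P' eq] sub[OF P' P eq[symmetric]] by blast
    moreover have "h = h'"
      by (rule PiE_ext[OF h]) (use h' PP sub[OF P P' eq] in auto)
    ultimately show "P = P' \<and> h = h'" by simp
  qed
  have "card {z \<in> C. (x, z) \<in> ord \<and> card z = s} = card ?S"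
    unfolding img by (rule card_image[OF inj])
  also have "\<dots> = (\<Sum>P\<in>?Ps. card (PiE P allowed))"
    using finPs finP cardG by (intro card_SigmaI) (auto intro!: finite_PiE)
  also have "\<dots> = (\<Sum>P\<in>?Ps. \<Prod>G\<in>P. card G)"
    using finP cardG by (intro sum.cong refl) (auto simp: card_PiE intro!: prod.cong)
  finally show ?thesis using sum_prod_card_partitions[OF finx] by simp
qed

section \<open>The minimum and the Whitney numbers\<close>

definition bottom :: "(nat set \<times> nat) set" where
  "bottom = (\<lambda>i. ({i}, d i)) ` {1..n}"

lemma card_bottom: "card bottom = n"
  unfolding bottom_def by (subst card_image) (auto simp: inj_on_def)

lemma bottom_C: "bottom \<in> C"
proof -
  have "d i \<in> dec {i}" if "i \<in> {1..n}" for i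
    using allowed_bottom[of "{i}"] allowed_single[of "({i}, d i)"] that by auto
  then show ?thesis by (auto simp: C_iff bottom_def)
qed

text \<open>Group the singletons according to the blocks of \<open>y\<close>; by
  \<open>allowed_bottom\<close> every decoration of a block of \<open>y\<close> can be reached from
  them.\<close>

lemma bottom_le:
  assumes y: "y \<in> C"
  shows "(bottom, y) \<in> ord"
proof -
  let ?b = "\<lambda>i. ({i}, d i)"
  let ?P = "(\<lambda>g. ?b ` fst g) ` y"
  let ?h = "\<lambda>G. THE v. (\<Union>(fst ` G), v) \<in> y"
  have U: "\<Union>(fst ` ?b ` A) = A" for A by auto
  have h: "?h (?b ` fst g) = snd g" if "g \<in> y" for g
    unfolding U
  proof (rule the_equality)
    show "(fst g, snd g) \<in> y" using that by simp
    fix v assume "(fst g, v) \<in> y"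
    then have "(fst g, v) = g" using C_disjoint[OF y, of g "(fst g, v)"] C_block[OF y that] that by auto
    then show "v = snd g" by (metis snd_conv)
  qed
  have P: "partition_on bottom ?P"
  proof (rule partition_onI)
    have "\<Union>?P = ?b ` \<Union>(fst ` y)" by auto
    then show "\<Union>?P = bottom" using y by (simp add: C_iff bottom_def)
    show "{} \<notin> ?P" using C_block[OF y] by fastforce
    fix p q assume "p \<in> ?P" "q \<in> ?P" "p \<noteq> q"
    then obtain g g' where g: "g \<in> y" "g' \<in> y" "p = ?b ` fst g" "q = ?b ` fst g'"
      unfolding image_iff[of _ "\<lambda>g. ?b ` fst g"] by blast
    then have "g \<noteq> g'" using \<open>p \<noteq> q\<close> by blast
    then show "disjnt p q" using C_disjoint[OF y g(1,2) \<open>g \<noteq> g'\<close>] g by (auto simp: disjnt_def)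
  qed
  have hP: "?h \<in> Pi ?P allowed"
  proof
    fix G assume "G \<in> ?P"
    then obtain g where g: "G = ?b ` fst g" "g \<in> y" by (rule imageE)
    have "allowed G = dec (fst g)" using allowed_bottom[of "fst g"] C_block[OF y g(2)] g(1) by simp
    then show "?h G \<in> allowed G" using h[OF g(2)] C_block[OF y g(2)] unfolding g(1) by simp
  qed
  have eq: "merge_blocks ?h ?P = y"
  proof -
    have "merge_blocks ?h ?P = (\<lambda>g. (\<Union>(fst ` ?b ` fst g), ?h (?b ` fst g))) ` y"
      by (simp add: merge_blocks_def image_image)
    also have "\<dots> = (\<lambda>g. g) ` y"
    proof (rule image_cong)
      fix g assume "g \<in> y"
      then show "(\<Union>(fst ` ?b ` fst g), ?h (?b ` fst g)) = g" unfolding U using h by (simp only: prod.collapse U)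
    qed simp
    finally show ?thesis by simp
  qed
  show ?thesis using merge_blocks_ord[OF bottom_C P hP] unfolding eq .
qed

sublocale graded_steps C "block_cover comb" "\<lambda>x. n - card x" bottom "n - 1"
proof
  show "finite C" by (rule finite_C)
  show "bottom \<in> C" by (rule bottom_C)
  show "n - card bottom = 0" by (simp add: card_bottom)
  show "(bottom, x) \<in> ord" if "x \<in> C" for x using that by (rule bottom_le)
  show "n - card x \<le> n - 1" if "x \<in> C" for x using card_pos[OF that] by auto
  fix x assume x: "x \<in> C" "n - card x < n - 1"
  then have "\<not> card x \<le> 1" by auto
  then have "\<exists>g\<in>x. \<exists>g'\<in>x. g \<noteq> g'"
    using finite_block_set[OF x(1)] by (metis card_le_Suc0_iff_eq One_nat_def)
  then obtain A p B q where ab: "(A, p) \<in> x" "(B, q) \<in> x" "(A, p) \<noteq> (B, q)" by force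
  obtain s where "s \<in> comb p q" using comb_nonempty by blast
  then have "block_cover comb x (insert (A \<union> B, s) (x - {(A, p), (B, q)}))"
    using ab unfolding block_cover_def by blast
  then show "\<exists>y\<in>C. block_cover comb x y" using step_C(1)[OF x(1)] by blast
qed

lemma card_above_rk:
  assumes "x \<in> C" "n - card x \<le> m" "m < n"
  shows "card {y \<in> C. (x, y) \<in> ord \<and> n - card y = m} = (n - (n - card x) choose (n - m)) * (n - m) ^ (m - (n - card x))"
proof -
  have "{y \<in> C. (x, y) \<in> ord \<and> n - card y = m} = {y \<in> C. (x, y) \<in> ord \<and> card y = n - m}"
    using card_le assms(3) by fastforce
  moreover have "n - (n - card x) = card x" "m - (n - card x) = card x - (n - m)"
    using card_le[OF assms(1)] assms(3) by auto
  ultimately show ?thesis using card_above[OF assms(1), of "n - m"] by simp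
qed

lemma whitney_second_eq: "whitney_second ord k = W2 n k"
proof (cases "k < n")
  case True
  have "{x \<in> C. n - card x = k} = {y \<in> C. (bottom, y) \<in> ord \<and> n - card y = k}"
    using bottom_le by auto
  then have "whitney_second ord k = (n choose (n - k)) * (n - k) ^ k"
    using card_above_rk[OF bottom_C, of k] True by (simp add: whitney_second_ord card_bottom)
  then show ?thesis using True binomial_symmetric[of k n] by (simp add: W2_def)
next
  case False
  then have e: "{x \<in> C. n - card x = k} = {}" using rk_le n_pos by fastforce
  have "whitney_second ord k = 0" unfolding whitney_second_ord e by simp
  then show ?thesis using False n_pos by (simp add: W2_eq_0)
qed

text \<open>Both sides solve the same triangular system: at \<open>k = m\<close> the coefficient is
  \<open>1\<close>, so the value at \<open>m\<close> follows from the earlier ones.\<close>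

lemma whitney_first_eq: "whitney_first ord k = (- 1) ^ k * int (W1 n k)"
proof (induction k rule: less_induct)
  case (less m)
  show ?case
  proof (cases "m < n")
    case False
    then have e: "{x \<in> C. n - card x = m} = {}" using rk_le n_pos by fastforce
    have "whitney_first ord m = 0" unfolding whitney_first_ord e by simp
    then show ?thesis using False n_pos by (simp add: W1_eq_0)
  next
    case m: True
    show ?thesis
    proof (cases "m = 0")
      case True
      then show ?thesis by (simp add: whitney_first_0)
    next
      case False
      let ?U = "\<lambda>k. (n - k choose (n - m)) * (n - m) ^ (m - k)"
      have "(\<Sum>k\<le>m. whitney_first ord k * int (?U k)) = 0"
        by (rule whitney_first_recurrence) (use card_above_rk m False in auto)
      moreover have "(\<Sum>k\<le>m. (- 1) ^ k * int (W1 n k) * int (?U k)) = 0"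
        by (rule W1_W2_orthogonal) (use m False in auto)
      moreover have "(\<Sum>k<m. whitney_first ord k * int (?U k)) = (\<Sum>k<m. (- 1) ^ k * int (W1 n k) * int (?U k))"
        using less by (intro sum.cong) auto
      moreover have "{..m} = insert m {..<m}" by auto
      ultimately show ?thesis by simp
    qed
  qed
qed

end

section \<open>The pointed and the weighted case\<close>

lemma decorated_pointed:
  assumes "0 < n"
  shows "decorated n (\<lambda>A. A) (\<lambda>p q. {p, q}) (\<lambda>G. snd ` G) (\<lambda>i. i)"
proof
  fix x G assume x: "x \<in> decorated_partitions (\<lambda>A. A) n" and G: "G \<subseteq> x"
  \<comment> \<open>Each point lies in its own block and the blocks are disjoint, so different
    blocks have different points.\<close>
  have "inj_on snd x"
  proof (rule inj_onI)
    fix g g' assume g: "g \<in> x" "g' \<in> x" "snd g = snd g'"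
    have dj: "disjoint (fst ` x)" and inj: "inj_on fst x" and m: "snd g \<in> fst g" "snd g' \<in> fst g'"
      using x g by (auto simp: decorated_partitions_def partition_on_def)
    then have "fst g = fst g'" using g by (auto simp: disjoint_def)
    then show "g = g'" using inj g by (auto simp: inj_on_def)
  qed
  then show "card (snd ` G) = card G" using G by (intro card_image) (rule inj_on_subset)
qed (use assms in \<open>auto simp: image_image intro: finite_subset\<close>)

text \<open>Joining the blocks of \<open>G\<close> takes \<open>card G - 1\<close> covers, each
  adding 0 or 1 to the total weight. The reachable weights form an interval with
  \<open>card G\<close> elements.\<close>

lemma decorated_weighted:
  assumes "0 < n"
  shows "decorated n (\<lambda>A. {0..card A - 1}) (\<lambda>p q. {p + q, p + q + 1})
    (\<lambda>G. {sum snd G..sum snd G + (card G - 1)}) (\<lambda>i. 0)"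
proof
  fix A B :: "nat set" and p q s
  assume "A \<subseteq> {1..n}" "B \<subseteq> {1..n}" "A \<noteq> {}" "B \<noteq> {}" "A \<inter> B = {}"
    and pq: "p \<in> {0..card A - 1}" "q \<in> {0..card B - 1}" "s \<in> {p + q, p + q + 1}"
  then have "finite A" "finite B" by (auto intro: finite_subset)
  then have "0 < card A" "0 < card B" "card (A \<union> B) = card A + card B"
    using \<open>A \<noteq> {}\<close> \<open>B \<noteq> {}\<close> \<open>A \<inter> B = {}\<close> by (auto simp: card_Un_disjoint card_gt_0_iff)
  then show "s \<in> {0..card (A \<union> B) - 1}" using pq by auto
next
  fix G H :: "(nat set \<times> nat) set"
  assume fin: "finite G" "finite H" and ne: "G \<noteq> {}" "H \<noteq> {}" and dj: "G \<inter> H = {}"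
  define s t k l where "s = sum snd G" and "t = sum snd H" and "k = card G - 1" and "l = card H - 1"
  have "0 < card G" "0 < card H" using fin ne by (auto simp: card_gt_0_iff)
  then have "card (G \<union> H) - 1 = Suc (k + l)" using fin dj by (auto simp: card_Un_disjoint k_def l_def)
  moreover have "sum snd (G \<union> H) = s + t" using fin dj by (simp add: sum.union_disjoint s_def t_def)
  moreover have "{s + t..s + t + Suc (k + l)} = (\<Union>p\<in>{s..s + k}. \<Union>q\<in>{t..t + l}. {p + q, p + q + 1})" (is "?L = ?R")
  proof
    show "?R \<subseteq> ?L" by auto
    show "?L \<subseteq> ?R"
    proof
      fix y assume y: "y \<in> ?L"
      define e where "e = y - (s + t)"
      have e: "y = s + t + e" "e \<le> Suc (k + l)" using y by (auto simp: e_def)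
      \<comment> \<open>The excess fills the first interval, then the second; the additional 1 is
        required only at the upper end \<open>k + l + 1\<close>.\<close>
      have "\<exists>a\<le>k. \<exists>b\<le>l. e = a + b \<or> e = a + b + 1"
      proof (cases "e \<le> k + l")
        case True
        then have "min e k \<le> k" "e - min e k \<le> l" "e = min e k + (e - min e k)" by auto
        then show ?thesis by blast
      next
        case False
        then have "e = k + l + 1" using e by simp
        then show ?thesis by blast
      qed
      then obtain a b where "a \<le> k" "b \<le> l" "e = a + b \<or> e = a + b + 1" by blast
      then have "s + a \<in> {s..s + k}" "t + b \<in> {t..t + l}" "y \<in> {(s + a) + (t + b), (s + a) + (t + b) + 1}"
        using e by auto
      then show "y \<in> ?R" by blast
    qed
  qed
  ultimately show "{sum snd (G \<union> H)..sum snd (G \<union> H) + (card (G \<union> H) - 1)} =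
    (\<Union>p\<in>{sum snd G..sum snd G + (card G - 1)}. \<Union>q\<in>{sum snd H..sum snd H + (card H - 1)}. {p + q, p + q + 1})"
    by (simp only: s_def t_def k_def l_def)
next
  fix x G assume x: "x \<in> decorated_partitions (\<lambda>A. {0..card A - 1}) n" and G: "G \<subseteq> x" "G \<noteq> {}"
  have "finite (fst ` x)" "inj_on fst x" 
    using x finite_elements[of "{1..n}" "fst ` x"] by (auto simp: decorated_partitions_def)
  then have "finite x" by (simp add: finite_image_iff)
  then have "0 < card G" using G by (auto simp: card_gt_0_iff intro: finite_subset)
  then show "card {sum snd G..sum snd G + (card G - 1)} = card G" by simp
next
  fix A :: "nat set" assume "A \<subseteq> {1..n}" "A \<noteq> {}"
  have "card ((\<lambda>i. ({i}, 0 :: nat)) ` A) = card A" by (intro card_image) (auto simp: inj_on_def)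
  moreover have "sum snd ((\<lambda>i. ({i}, 0 :: nat)) ` A) = 0" by (intro sum.neutral) auto
  ultimately show "{sum snd ((\<lambda>i. ({i}, 0 :: nat)) ` A)..sum snd ((\<lambda>i. ({i}, 0 :: nat)) ` A) + (card ((\<lambda>i. ({i}, 0 :: nat)) ` A) - 1)}
      = {0..card A - 1}" by simp
qed (use assms in auto)

lemma pointed_cover_eq: "pointed_cover = block_cover (\<lambda>p q. {p, q})"
  by (intro ext) (simp add: pointed_cover_def block_cover_def)

lemma weighted_cover_eq: "weighted_cover = block_cover (\<lambda>p q. {p + q, p + q + 1})"
  by (intro ext) (simp add: weighted_cover_def block_cover_def)

lemma pointed_partition_poset_numbers:
  assumes "0 < n"
  shows "graded_poset_with_min (pointed_partition_poset n)"
    and "whitney_second (pointed_partition_poset n) k = W2 n k"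
    and "whitney_first (pointed_partition_poset n) k = (- 1) ^ k * int (W1 n k)"
proof -
  interpret decorated n "\<lambda>A. A" "\<lambda>p q. {p, q}" "\<lambda>G. snd ` G" "\<lambda>i. i"
    by (rule decorated_pointed[OF assms])
  have eq: "pointed_partition_poset n = ord"
    by (simp add: pointed_partition_poset_def pointed_partitions_def pointed_cover_eq)
  show "graded_poset_with_min (pointed_partition_poset n)" unfolding eq by (rule graded_ord)
  show "whitney_second (pointed_partition_poset n) k = W2 n k" unfolding eq by (rule whitney_second_eq)
  show "whitney_first (pointed_partition_poset n) k = (- 1) ^ k * int (W1 n k)"
    unfolding eq by (rule whitney_first_eq)
qed

lemma weighted_partition_poset_numbers:
  assumes "0 < n"
  shows "graded_poset_with_min (weighted_partition_poset n)"
    and "whitney_second (weighted_partition_poset n) k = W2 n k"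
    and "whitney_first (weighted_partition_poset n) k = (- 1) ^ k * int (W1 n k)"
proof -
  interpret decorated n "\<lambda>A. {0..card A - 1}" "\<lambda>p q. {p + q, p + q + 1}"
    "\<lambda>G. {sum snd G..sum snd G + (card G - 1)}" "\<lambda>i. 0"
    by (rule decorated_weighted[OF assms])
  have eq: "weighted_partition_poset n = ord"
    by (simp add: weighted_partition_poset_def weighted_partitions_def weighted_cover_eq)
  show "graded_poset_with_min (weighted_partition_poset n)" unfolding eq by (rule graded_ord)
  show "whitney_second (weighted_partition_poset n) k = W2 n k" unfolding eq by (rule whitney_second_eq)
  show "whitney_first (weighted_partition_poset n) k = (- 1) ^ k * int (W1 n k)"
    unfolding eq by (rule whitney_first_eq)
qed

section \<open>Layered posets\<close>

text \<open>The duals are to be posets on \<open>btree set\<close>, so the pair of rank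
  \<open>k\<close> and index \<open>i\<close> is stored in the two leaves of a tree. The tree has no
  other meaning.\<close>

definition layer_elem :: "nat \<Rightarrow> nat \<Rightarrow> btree set" where
  "layer_elem k i = {Node False (Leaf k) (Leaf i)}"

definition layer_rank :: "btree set \<Rightarrow> nat" where
  "layer_rank x = hd (leaves (the_elem x))"

definition layer_index :: "btree set \<Rightarrow> nat" where
  "layer_index x = last (leaves (the_elem x))"

lemma layer_elem_simps [simp]:
  "layer_rank (layer_elem k i) = k" "layer_index (layer_elem k i) = i"
  "layer_elem k i = layer_elem k' i' \<longleftrightarrow> k = k' \<and> i = i'"
  by (auto simp: layer_elem_def layer_rank_def layer_index_def)

text \<open>Layer \<open>k\<close> has \<open>W1 n k\<close> elements. For \<open>k \<ge> 2\<close>, the first \<open>W2 n k\<close> of them cover two elements and have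
  Moebius value \<open>\<plusminus>1\<close>; the others cover a single element, hence have Moebius value \<open>0\<close>, and there
  are enough of them for every element of layer \<open>k - 1\<close> to be covered. If \<open>c\<close> holds, element \<open>2\<close> of
  layer \<open>2\<close> covers three elements and has Moebius value \<open>2\<close>, which is compensated by element \<open>3\<close>.\<close>

locale layered =
  fixes n :: nat and c :: bool
  assumes n_ge_4: "4 \<le> n"
begin

definition width :: "nat \<Rightarrow> nat \<Rightarrow> nat" where
  "width k i = (if c \<and> k = 2 \<and> i = 2 then 3 else if c \<and> k = 2 \<and> i = 3 then 1 else 2)"

text \<open>The indices of the elements covered by element \<open>i\<close> of layer
  \<open>k\<close>. From layer 2 on, index \<open>W2 n k + j\<close> covers just \<open>j\<close>,
  so each \<open>j\<close> in the layer below is covered; indices left over fall back to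
  \<open>0\<close>.\<close>

definition low :: "nat \<Rightarrow> nat \<Rightarrow> nat set" where
  "low k i = (if k = 1 then {0} else if i < W2 n k then {..<width k i}
     else if i - W2 n k < W1 n (k - 1) then {i - W2 n k} else {0})"

text \<open>If \<open>w\<close> elements of Moebius value \<open>(- 1) ^ (k - 1)\<close> with a
  common strict lower set are covered, the values strictly below add up to
  \<open>(w - 1) * (- 1) ^ (k - 1)\<close>, which explains the factor
  \<open>width k i - 1\<close>.\<close>

definition mob :: "nat \<Rightarrow> nat \<Rightarrow> int" where
  "mob k i = (if k \<le> 1 then (- 1) ^ k else if i < W2 n k then (- 1) ^ k * (int (width k i) - 1) else 0)"

definition layers :: "btree set set" where
  "layers = {layer_elem k i | k i. k < n \<and> i < W1 n k}"

definition layer_step :: "btree set \<Rightarrow> btree set \<Rightarrow> bool" where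
  "layer_step x y \<longleftrightarrow> (\<exists>k i j. x = layer_elem k j \<and> y = layer_elem (Suc k) i \<and> j \<in> low (Suc k) i)"

lemma layers_elem [simp]: "layer_elem k i \<in> layers \<longleftrightarrow> k < n \<and> i < W1 n k"
  by (auto simp: layers_def)

lemma layer_step_elem [simp]:
  "layer_step (layer_elem k j) (layer_elem l i) \<longleftrightarrow> l = Suc k \<and> j \<in> low l i"
  by (auto simp: layer_step_def)

lemma layersE:
  assumes "x \<in> layers"
  obtains k i where "x = layer_elem k i" "k < n" "i < W1 n k"
  using assms by (auto simp: layers_def)

lemma W2_le_W1: "0 < k \<Longrightarrow> k < n \<Longrightarrow> W2 n k \<le> W1 n k"
  using W1_W2_gap[of k n] by (cases "k = 1") (auto simp: W1_1 W2_1)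

lemma four_le_W2: "0 < k \<Longrightarrow> k < n \<Longrightarrow> 4 \<le> W2 n k"
  using W2_ge[of k n] n_ge_4 by linarith

lemma four_le_W1: "0 < k \<Longrightarrow> k < n \<Longrightarrow> 4 \<le> W1 n k"
  using four_le_W2 W2_le_W1 le_trans by blast

lemma width_bounds: "0 < width k i" "width k i \<le> 3" "k \<noteq> 2 \<Longrightarrow> width k i = 2"
  by (auto simp: width_def)

lemma low_bounds:
  assumes "0 < k" "k < n"
  shows "low k i \<noteq> {}" "low k i \<subseteq> {..<W1 n (k - 1)}"
proof -
  have w: "0 < width k i" "width k i \<le> 3" by (rule width_bounds)+
  show "low k i \<noteq> {}" using w by (auto simp: low_def lessThan_empty_iff)
  show "low k i \<subseteq> {..<W1 n (k - 1)}"
  proof (cases "k = 1")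
    case True
    then show ?thesis by (simp add: low_def)
  next
    case False
    then have "4 \<le> W1 n (k - 1)" using four_le_W1[of "k - 1"] assms by auto
    then show ?thesis using w by (auto simp: low_def)
  qed
qed

sublocale ranked_steps layers layer_step layer_rank
  by unfold_locales (auto simp: layer_step_def)

sublocale graded_steps layers layer_step layer_rank "layer_elem 0 0" "n - 1"
proof
  have "layers = (\<lambda>(k, i). layer_elem k i) ` (SIGMA k:{..<n}. {..<W1 n k})"
    by (auto simp: layers_def)
  then show "finite layers" by simp
  show "layer_elem 0 0 \<in> layers" using n_ge_4 by simp
  show "layer_rank (layer_elem 0 0) = 0" by simp
  show "layer_rank x \<le> n - 1" if "x \<in> layers" for x
    using that by (auto elim!: layersE)
  show "(layer_elem 0 0, x) \<in> ord" if "x \<in> layers" for x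
  proof -
    have "i < W1 n k \<Longrightarrow> k < n \<Longrightarrow> (layer_elem 0 0, layer_elem k i) \<in> ord" for k i
    proof (induction k arbitrary: i)
      case 0
      then show ?case by (simp add: ord_refl)
    next
      case (Suc k)
      obtain j where j: "j \<in> low (Suc k) i" "j < W1 n k"
        using low_bounds[of "Suc k" i] Suc.prems by auto
      then have "(layer_elem k j, layer_elem (Suc k) i) \<in> ord"
        using Suc.prems by (intro ord_step) auto
      moreover have "(layer_elem 0 0, layer_elem k j) \<in> ord" using Suc.IH[OF j(2)] Suc.prems by simp
      ultimately show ?case by (rule ord_trans[rotated])
    qed
    then show ?thesis using that by (auto elim: layersE)
  qed
  show "\<exists>y\<in>layers. layer_step x y" if x: "x \<in> layers" "layer_rank x < n - 1" for x
  proof -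
    obtain k j where k: "x = layer_elem k j" "j < W1 n k" using x(1) by (auto elim: layersE)
    then have kn: "Suc k < n" using x(2) by auto
    \<comment> \<open>The index reserved for covering \<open>j\<close> alone; in layer 1 every
      element covers the minimum, so any index will do. It lies within the layer by
      \<open>W1_W2_gap\<close>.\<close>
    define i where "i = (if k = 0 then 0 else W2 n (Suc k) + j)"
    have "i < W1 n (Suc k)"
    proof (cases "k = 0")
      case True
      then show ?thesis using four_le_W1[of "Suc k"] kn by (simp add: i_def)
    next
      case False
      then show ?thesis using W1_W2_gap[of "Suc k" n] kn k(2) by (simp add: i_def)
    qed
    moreover have "j \<in> low (Suc k) i"
      using k(2) by (auto simp: low_def i_def)
    ultimately have "layer_elem (Suc k) i \<in> layers" "layer_step x (layer_elem (Suc k) i)"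
      using k kn by auto
    then show ?thesis by blast
  qed
qed

section \<open>Lower sets and Moebius values in the layered posets\<close>

lemma under_layer:
  assumes "Suc k < n" "i < W1 n (Suc k)"
  shows "under ord (layer_elem (Suc k) i) =
    insert (layer_elem (Suc k) i) (\<Union>j\<in>low (Suc k) i. under ord (layer_elem k j))" (is "?L = ?R")
proof
  have x: "layer_elem (Suc k) i \<in> layers" using assms by simp
  show "?R \<subseteq> ?L"
  proof
    fix y assume y: "y \<in> ?R"
    show "y \<in> ?L"
    proof (cases "y = layer_elem (Suc k) i")
      case True
      then show ?thesis using ord_refl[OF x] by (simp add: under_def)
    next
      case False
      then obtain j where j: "j \<in> low (Suc k) i" "(y, layer_elem k j) \<in> ord"
        using y by (auto simp: under_def)
      have "layer_elem k j \<in> layers" using ord_carrier[OF j(2)] by simp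
      from ord_step[OF this x] j(1) have "(layer_elem k j, layer_elem (Suc k) i) \<in> ord" by simp
      then show ?thesis using ord_trans[OF j(2)] by (simp add: under_def)
    qed
  qed
  show "?L \<subseteq> ?R"
  proof
    fix y assume y: "y \<in> ?L"
    show "y \<in> ?R"
    proof (cases "y = layer_elem (Suc k) i")
      case False
      have "(y, layer_elem (Suc k) i) \<in> ord" using y by (simp add: under_def)
      then obtain u where u: "(y, u) \<in> ord" "u \<in> layers" "layer_step u (layer_elem (Suc k) i)"
        using False by (rule ord_last_step)
      obtain l j where lj: "u = layer_elem l j" using u(2) by (rule layersE)
      then have "l = k" "j \<in> low (Suc k) i" using u(3) by auto
      then show ?thesis using u(1) lj unfolding under_def by blast
    qed simp
  qed
qed

lemma under_layer_0: "under ord (layer_elem 0 0) = {layer_elem 0 0}"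
  by (rule under_z)

lemma finite_under: "finite (under ord x)"
  using under_subset finite_C finite_subset by blast

lemma layer_notin_lower:
  assumes "Suc k < n" "i < W1 n (Suc k)" "j < W1 n k"
  shows "layer_elem (Suc k) i \<notin> under ord (layer_elem k j)"
proof
  assume "layer_elem (Suc k) i \<in> under ord (layer_elem k j)"
  then have "(layer_elem (Suc k) i, layer_elem k j) \<in> ord" by (simp add: under_def)
  from ord_rk[OF this] show False by auto
qed

text \<open>The core elements \<open>0\<close> and \<open>1\<close> of a layer, and all elements of layer \<open>1\<close>, have the same
  elements strictly below them, and this makes the sums over lower sets easy to evaluate.\<close>

definition core :: "nat \<Rightarrow> nat \<Rightarrow> bool" where
  "core k i \<longleftrightarrow> i < 2 \<or> k = 1"

lemma core_low: "0 < k \<Longrightarrow> k < n \<Longrightarrow> core k i \<Longrightarrow> i < 3 \<Longrightarrow> low k i = low k 0 \<and> mob k i = (- 1) ^ k"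
  using four_le_W2[of k] by (auto simp: core_def low_def mob_def width_def)

lemma sum_mob_under:
  assumes "0 < k" "k < n" "i < W1 n k"
  shows "(\<Sum>y\<in>under ord (layer_elem k i). mob (layer_rank y) (layer_index y)) = 0"
  using assms
proof (induction k arbitrary: i)
  case 0
  then show ?case by simp
next
  case (Suc k)
  let ?f = "\<lambda>y. mob (layer_rank y) (layer_index y)"
  show ?case
  proof (cases "k = 0")
    case True
    then have "under ord (layer_elem (Suc k) i) = {layer_elem 1 i, layer_elem 0 0}"
      using under_layer[OF Suc.prems(2,3)] by (auto simp: low_def under_layer_0)
    then show ?thesis by (simp add: mob_def)
  next
    case False
    note und = under_layer[OF Suc.prems(2,3)]
    have kn: "0 < k" "k < n" using False Suc.prems by auto
    show ?thesis
    proof (cases "i < W2 n (Suc k)")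
      case True
      define w where "w = width (Suc k) i"
      have w: "0 < w" "w \<le> 3" "k \<noteq> 1 \<Longrightarrow> w = 2"
        using width_bounds[of "Suc k" i] by (auto simp: w_def)
      have low: "low (Suc k) i = {..<w}" using True False by (simp add: low_def w_def)
      have core: "core k j" if "j < w" for j using that w by (auto simp: core_def)
      \<comment> \<open>The strict lower set shared by all the elements of layer \<open>k\<close>
        that are covered here.\<close>
      define D where "D = (\<Union>j\<in>low k 0. under ord (layer_elem (k - 1) j))"
      have j_lt: "j < W1 n k" if "j < w" for j
        using four_le_W1[OF kn] w that by auto
      have und_j: "under ord (layer_elem k j) = insert (layer_elem k j) D" if "j < w" for j
        using under_layer[of "k - 1" j] kn core_low[OF kn core[OF that]] w that j_lt[OF that] by (simp add: D_def)
      have not_D: "layer_elem k j \<notin> D" if "j < w" for j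
      proof
        assume "layer_elem k j \<in> D"
        then obtain l where "l \<in> low k 0" "layer_elem k j \<in> under ord (layer_elem (k - 1) l)"
          by (auto simp: D_def)
        then show False using layer_notin_lower[of "k - 1" j l] kn low_bounds(2)[OF kn] j_lt[OF that] by auto
      qed
      have finD: "finite D" using finite_under[of "layer_elem k 0"] und_j[of 0] w by simp
      have fcore: "?f (layer_elem k j) = (- 1) ^ k" if "j < w" for j
        using core_low[OF kn core[OF that]] w that by simp
      \<comment> \<open>The induction hypothesis for one covered element gives the sum over
        \<open>D\<close>; the others contribute only their own values.\<close>
      have "sum ?f D + (- 1) ^ k = 0"
        using Suc.IH[OF kn j_lt[of 0]] und_j[of 0] not_D[of 0] finD fcore[of 0] w by simp
      then have sD: "sum ?f D = - ((- 1) ^ k)" by simp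
      have "under ord (layer_elem (Suc k) i) = insert (layer_elem (Suc k) i) (layer_elem k ` {..<w} \<union> D)"
        unfolding und low using und_j w(1) by auto
      moreover have "layer_elem (Suc k) i \<notin> layer_elem k ` {..<w} \<union> D"
        using layer_notin_lower[OF Suc.prems(2,3) j_lt[of 0]] und_j[of 0] w by auto
      moreover have "sum ?f (layer_elem k ` {..<w} \<union> D) = int w * (- 1) ^ k + sum ?f D"
      proof (subst sum.union_disjoint)
        show "layer_elem k ` {..<w} \<inter> D = {}" using not_D by auto
        have "sum ?f (layer_elem k ` {..<w}) = (\<Sum>j<w. ?f (layer_elem k j))"
          by (rule sum.reindex_cong[of "layer_elem k"]) (auto simp: inj_on_def)
        also have "\<dots> = (\<Sum>j<w. (- 1) ^ k)" using fcore by (intro sum.cong) auto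
        finally show "sum ?f (layer_elem k ` {..<w}) + sum ?f D = int w * (- 1) ^ k + sum ?f D" by simp
      qed (use finD in auto)
      ultimately have "sum ?f (under ord (layer_elem (Suc k) i)) = ?f (layer_elem (Suc k) i) + (int w * (- 1) ^ k - (- 1) ^ k)"
        using finD sD by simp
      also have "?f (layer_elem (Suc k) i) = (- 1) ^ Suc k * (int w - 1)"
        using True False by (simp add: mob_def w_def)
      finally show ?thesis by (simp add: algebra_simps)
    next
      case i: False
      \<comment> \<open>With a single covered element, the strict lower set is a principal one of
        positive rank, whose sum is already zero.\<close>
      then obtain j where low: "low (Suc k) i = {j}"
        using False by (cases "i - W2 n (Suc k) < W1 n k") (auto simp: low_def)
      then have j: "j < W1 n k" using low_bounds(2)[of "Suc k" i] Suc.prems by auto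
      have "sum ?f (under ord (layer_elem (Suc k) i)) = ?f (layer_elem (Suc k) i) + sum ?f (under ord (layer_elem k j))"
        unfolding und low using finite_under layer_notin_lower[OF Suc.prems(2,3) j] by simp
      then show ?thesis using Suc.IH[OF kn j] i False by (simp add: mob_def)
    qed
  qed
qed

lemma mobius_layer:
  assumes "k < n" "i < W1 n k"
  shows "mobius ord (layer_elem 0 0) (layer_elem k i) = mob k i"
proof -
  have "mobius ord (layer_elem 0 0) (layer_elem k i) =
      mob (layer_rank (layer_elem k i)) (layer_index (layer_elem k i))"
  proof (rule mobius_eqI)
    show "mob (layer_rank (layer_elem 0 0)) (layer_index (layer_elem 0 0)) = 1" by (simp add: mob_def)
    show "layer_elem k i \<in> layers" using assms by simp
    fix x assume x: "x \<in> layers" "x \<noteq> layer_elem 0 0"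
    then obtain l j where "x = layer_elem l j" "l < n" "j < W1 n l" by (auto elim: layersE)
    moreover from this have "0 < l" using x(2) by (cases l) auto
    ultimately show "(\<Sum>y\<in>under ord x. mob (layer_rank y) (layer_index y)) = 0"
      using sum_mob_under by simp
  qed
  then show ?thesis by simp
qed

lemma rank_layer: "k < n \<Longrightarrow> {x \<in> layers. layer_rank x = k} = layer_elem k ` {..<W1 n k}"
  by (auto simp: layers_def)

lemma rank_layer_empty: "\<not> k < n \<Longrightarrow> {x \<in> layers. layer_rank x = k} = {}"
  by (auto simp: layers_def)

lemma whitney_second_layer: "whitney_second ord k = W1 n k"
proof (cases "k < n")
  case True
  show ?thesis
    unfolding whitney_second_ord rank_layer[OF True] by (subst card_image) (auto simp: inj_on_def)
next
  case False
  show ?thesis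
    unfolding whitney_second_ord rank_layer_empty[OF False] using False n_ge_4 by (simp add: W1_eq_0)
qed

text \<open>The altered widths 3 and 1 average to the usual 2, so the sum of Moebius values on the
  layer does not depend on \<open>c\<close>.\<close>

lemma sum_width:
  assumes "0 < k" "k < n"
  shows "(\<Sum>i<W2 n k. int (width k i) - 1) = int (W2 n k)"
proof -
  have "{..<W2 n k} = {0, 1, 2, 3} \<union> {4..<W2 n k}" using four_le_W2[OF assms] by auto
  then have "(\<Sum>i<W2 n k. int (width k i) - 1)
    = (\<Sum>i\<in>{0, 1, 2, 3}. int (width k i) - 1) + (\<Sum>i\<in>{4..<W2 n k}. int (width k i) - 1)"
    by (simp only:) (rule sum.union_disjoint, auto)
  also have "(\<Sum>i\<in>{4..<W2 n k}. int (width k i) - 1) = (\<Sum>i\<in>{4..<W2 n k}. 1)"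
    by (intro sum.cong) (auto simp: width_def)
  also have "(\<Sum>i\<in>{0, 1, 2, 3}. int (width k i) - 1) = 4" by (simp add: width_def)
  finally show ?thesis using four_le_W2[OF assms] by simp
qed

lemma whitney_first_layer: "whitney_first ord k = (- 1) ^ k * int (W2 n k)"
proof (cases "k < n")
  case True
  have "whitney_first ord k = (\<Sum>i<W1 n k. mob k i)"
    unfolding whitney_first_ord rank_layer[OF True]
    by (rule sum.reindex_cong[of "layer_elem k"]) (auto simp: inj_on_def mobius_layer True)
  also have "\<dots> = (- 1) ^ k * int (W2 n k)"
  proof (cases "k \<le> 1")
    case True
    then consider "k = 0" | "k = 1" by linarith
    then show ?thesis by cases (auto simp: mob_def W1_1 W2_1)
  next
    case False
    have k: "0 < k" using False by simp
    have "(\<Sum>i<W1 n k. mob k i) = (\<Sum>i<W2 n k. mob k i)"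
      using W2_le_W1[OF k \<open>k < n\<close>] False by (intro sum.mono_neutral_right) (auto simp: mob_def)
    also have "\<dots> = (\<Sum>i<W2 n k. (- 1) ^ k * (int (width k i) - 1))"
      using False by (intro sum.cong) (auto simp: mob_def)
    finally show ?thesis using sum_width[OF k \<open>k < n\<close>] by (simp add: sum_distrib_left[symmetric])
  qed
  finally show ?thesis .
next
  case False
  show ?thesis
    unfolding whitney_first_ord rank_layer_empty[OF False] using False n_ge_4 by (simp add: W2_eq_0)
qed

text \<open>A property invariant under isomorphism that detects the local change: without it every
  element covers at most two others.\<close>

lemma covers_three_iff:
  "(\<exists>x y1 y2 y3. covers ord y1 x \<and> covers ord y2 x \<and> covers ord y3 x \<and> y1 \<noteq> y2 \<and> y1 \<noteq> y3 \<and> y2 \<noteq> y3) \<longleftrightarrow> c"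
proof
  assume c
  have W: "4 \<le> W1 n 2" "4 \<le> W2 n 2" "4 \<le> W1 n 1" using four_le_W1[of 2] four_le_W2[of 2] four_le_W1[of 1] n_ge_4 by auto
  have "covers ord (layer_elem 1 j) (layer_elem 2 2)" if "j < 3" for j
  proof -
    have "low 2 2 = {..<3}" unfolding low_def width_def using \<open>c\<close> W by auto
    then show ?thesis unfolding covers_iff_step using that W n_ge_4 by simp
  qed
  from this[of 0] this[of 1] this[of 2]
  show "\<exists>x y1 y2 y3. covers ord y1 x \<and> covers ord y2 x \<and> covers ord y3 x \<and> y1 \<noteq> y2 \<and> y1 \<noteq> y3 \<and> y2 \<noteq> y3"
    by (intro exI[of _ "layer_elem 2 2"] exI[of _ "layer_elem 1 0"] exI[of _ "layer_elem 1 1"] exI[of _ "layer_elem 1 2"]) auto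
next
  assume "\<exists>x y1 y2 y3. covers ord y1 x \<and> covers ord y2 x \<and> covers ord y3 x \<and> y1 \<noteq> y2 \<and> y1 \<noteq> y3 \<and> y2 \<noteq> y3"
  then obtain x y1 y2 y3 where s: "layer_step y1 x" "layer_step y2 x" "layer_step y3 x"
    and ne: "y1 \<noteq> y2" "y1 \<noteq> y3" "y2 \<noteq> y3" unfolding covers_iff_step by blast
  obtain k i j1 where 1: "y1 = layer_elem k j1" "x = layer_elem (Suc k) i" "j1 \<in> low (Suc k) i"
    using s(1) unfolding layer_step_def by blast
  have "\<exists>j. y = layer_elem k j \<and> j \<in> low (Suc k) i" if "layer_step y x" for y
    using that unfolding layer_step_def 1(2) layer_elem_simps by blast
  then obtain j2 j3 where j: "y2 = layer_elem k j2" "j2 \<in> low (Suc k) i"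
    "y3 = layer_elem k j3" "j3 \<in> low (Suc k) i" using s(2,3) by blast
  show c
  proof (rule ccontr)
    assume "\<not> c"
    then have "width (Suc k) i = 2" unfolding width_def by simp
    then have "low (Suc k) i \<in> {{0}, {..<2}, {i - W2 n (Suc k)}}" unfolding low_def by simp
    then have "low (Suc k) i = {..<2} \<or> (\<exists>j. low (Suc k) i = {j})" by blast
    moreover have "j1 \<noteq> j2" "j1 \<noteq> j3" "j2 \<noteq> j3" using ne unfolding 1(1) j(1,3) by simp_all
    moreover note 1(3) j(2,4)
    ultimately show False by (elim disjE exE) (auto, linarith?)
  qed
qed

end

lemma poset_isomorphic_covers_three:
  assumes "poset_isomorphic r s" "covers r y1 x" "covers r y2 x" "covers r y3 x" "y1 \<noteq> y2" "y1 \<noteq> y3" "y2 \<noteq> y3"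
  shows "\<exists>x y1 y2 y3. covers s y1 x \<and> covers s y2 x \<and> covers s y3 x \<and> y1 \<noteq> y2 \<and> y1 \<noteq> y3 \<and> y2 \<noteq> y3"
proof -
  obtain f where f: "bij_betw f (Field r) (Field s)"
    "\<forall>x\<in>Field r. \<forall>y\<in>Field r. (x, y) \<in> r \<longleftrightarrow> (f x, f y) \<in> s"
    using assms(1) by (auto simp: poset_isomorphic_def)
  have F: "x \<in> Field r" "y1 \<in> Field r" "y2 \<in> Field r" "y3 \<in> Field r"
    using assms(2-4) by (auto simp: covers_def Field_def)
  then have "f y1 \<noteq> f y2" "f y1 \<noteq> f y3" "f y2 \<noteq> f y3"
    using f(1) assms(5-7) by (auto simp: bij_betw_def inj_on_def)
  then show ?thesis using poset_isomorphic_covers[OF f] F assms(2-4) by blast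
qed

text \<open>Only gradedness and the Whitney numbers of \<open>R\<close> enter, so the same two
  layered posets serve for both partition posets.\<close>

lemma two_Whitney_duals:
  assumes n: "4 \<le> n" and gr: "graded_poset_with_min R"
    and R2: "\<And>k. whitney_second R k = W2 n k"
    and R1: "\<And>k. whitney_first R k = (- 1) ^ k * int (W1 n k)"
  shows "\<exists>(P :: btree set rel) (Q :: btree set rel).
    whitney_duals P R \<and> whitney_duals Q R \<and> \<not> poset_isomorphic P Q"
proof -
  interpret P: layered n True by unfold_locales (rule n)
  interpret Q: layered n False by unfold_locales (rule n)
  have "whitney_duals P.ord R" "whitney_duals Q.ord R"
    using gr P.graded_ord Q.graded_ord
    by (auto simp: whitney_duals_def R1 R2 P.whitney_first_layer P.whitney_second_layer
        Q.whitney_first_layer Q.whitney_second_layer abs_mult power_abs)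
  moreover have "\<not> poset_isomorphic P.ord Q.ord"
  proof
    assume iso: "poset_isomorphic P.ord Q.ord"
    obtain x y1 y2 y3 where "covers P.ord y1 x" "covers P.ord y2 x" "covers P.ord y3 x"
      "y1 \<noteq> y2" "y1 \<noteq> y3" "y2 \<noteq> y3"
      using P.covers_three_iff by auto
    from poset_isomorphic_covers_three[OF iso this] show False using Q.covers_three_iff by auto
  qed
  ultimately show ?thesis by blast
qed

section \<open>Covers in the posets of Lyndon forests\<close>

text \<open>Phrased through covers only, hence invariant under isomorphism. An element
  \<open>z\<close> that covers nothing takes the place of the minimum, and \<open>a\<close> that of
  an atom.\<close>

definition has_lonely_cover :: "'a rel \<Rightarrow> bool" where
  "has_lonely_cover r \<longleftrightarrow> (\<exists>z a. z \<in> Field r \<and> (\<forall>w. \<not> covers r w z) \<and> covers r z a \<and>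
     (\<exists>!y. covers r a y \<and> (\<forall>b. covers r b y \<longrightarrow> b = a)))"

lemma poset_isomorphic_lonely_cover:
  assumes iso: "poset_isomorphic r s" and sp: "has_lonely_cover r"
  shows "has_lonely_cover s"
proof -
  obtain f where f: "bij_betw f (Field r) (Field s)"
    "\<forall>x\<in>Field r. \<forall>y\<in>Field r. (x, y) \<in> r \<longleftrightarrow> (f x, f y) \<in> s"
    using iso by (auto simp: poset_isomorphic_def)
  have cov: "covers s (f x) (f y) \<longleftrightarrow> covers r x y" if "x \<in> Field r" "y \<in> Field r" for x y
    using poset_isomorphic_covers[OF f that] by simp
  have Fr: "x \<in> Field r \<and> y \<in> Field r" if "covers r x y" for x y
    using that by (auto simp: covers_def Field_def)
  have Fs: "x \<in> f ` Field r \<and> y \<in> f ` Field r" if "covers s x y" for x y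
    using that f(1) by (auto simp: covers_def Field_def bij_betw_def)
  have inj: "f x = f y \<longleftrightarrow> x = y" if "x \<in> Field r" "y \<in> Field r" for x y
    using f(1) that by (auto simp: bij_betw_def inj_on_def)
  have lonely: "(\<forall>b. covers s b (f y) \<longrightarrow> b = f a) \<longleftrightarrow> (\<forall>b. covers r b y \<longrightarrow> b = a)"
    if "y \<in> Field r" "a \<in> Field r" for y a
  proof safe
    fix b assume h: "\<forall>b. covers s b (f y) \<longrightarrow> b = f a" and b: "covers r b y"
    then have "b \<in> Field r" using Fr by blast
    then show "b = a" using h b cov that inj by blast
  next
    fix b assume h: "\<forall>b. covers r b y \<longrightarrow> b = a" and b: "covers s b (f y)"
    then obtain b' where "b' \<in> Field r" "b = f b'" using Fs by blast
    then show "b = f a" using h b cov that by blast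
  qed
  obtain z a y where z: "z \<in> Field r" "\<forall>w. \<not> covers r w z" "covers r z a"
    and y: "covers r a y" "\<forall>b. covers r b y \<longrightarrow> b = a"
    and un: "\<And>y'. covers r a y' \<Longrightarrow> \<forall>b. covers r b y' \<longrightarrow> b = a \<Longrightarrow> y' = y"
    using sp unfolding has_lonely_cover_def by (elim exE conjE ex1E) (meson)
  have a: "a \<in> Field r" and yF: "y \<in> Field r" using Fr[OF y(1)] by auto
  show ?thesis
    unfolding has_lonely_cover_def
  proof (intro exI conjI)
    show "f z \<in> Field s" using z(1) f(1) by (auto simp: bij_betw_def)
    show "\<forall>w. \<not> covers s w (f z)"
    proof (intro allI notI)
      fix w assume w: "covers s w (f z)"
      then obtain w' where "w' \<in> Field r" "w = f w'" using Fs by blast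
      then show False using w cov z(1,2) by blast
    qed
    show "covers s (f z) (f a)" using cov z a by blast
    show "\<exists>!y. covers s (f a) y \<and> (\<forall>b. covers s b y \<longrightarrow> b = f a)"
    proof (intro ex1I[of _ "f y"] conjI)
      show "covers s (f a) (f y)" using cov a yF y by blast
      show "\<forall>b. covers s b (f y) \<longrightarrow> b = f a" using lonely[OF yF a] y by blast
      fix v assume v: "covers s (f a) v \<and> (\<forall>b. covers s b v \<longrightarrow> b = f a)"
      then obtain u where u: "u \<in> Field r" "v = f u" using Fs by blast
      then have "covers r a u" "\<forall>b. covers r b u \<longrightarrow> b = a" using v cov a lonely by blast+
      then show "v = f y" using un u by blast
    qed
  qed
qed

section \<open>Recursive forms of the tree conditions, and merges of small trees\<close>

lemma leaves_nonempty [simp]: "leaves T \<noteq> []"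
  by (induction T) auto

lemma nu_in_leaves: "nu T \<in> set (leaves T)"
  unfolding nu_def by (rule Min_in) auto

lemma nu_simps [simp]: "nu (Leaf i) = i" "nu (Node c L R) = min (nu L) (nu R)"
  by (auto simp: nu_def Min_Un)

lemma internal_simps [simp]: "\<not> internal (Leaf i)" "internal (Node c L R)"
  by (auto simp: internal_def)

lemma subtrees_self [simp]: "T \<in> subtrees T"
  by (cases T) auto

lemma vertices_simps [simp]:
  "vertices (Leaf i) = {}" "vertices (Node c L R) = insert (Node c L R) (vertices L \<union> vertices R)"
  by (auto simp: vertices_def)

lemma normalized_simps [simp]:
  "normalized (Leaf i)"
  "normalized (Node c L R) \<longleftrightarrow> nu L \<le> nu R \<and> normalized L \<and> normalized R"
  by (auto simp: normalized_def)

lemma pointed_lyndon_simps [simp]: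
  "pointed_lyndon (Leaf i)"
  "pointed_lyndon (Node c L R) \<longleftrightarrow> nu L \<le> nu R \<and> pointed_lyndon L \<and> pointed_lyndon R \<and>
     (internal L \<longrightarrow> c \<le> color L \<and> (color L \<and> c \<longrightarrow> nu R < nu (right L)))"
  by (auto simp: pointed_lyndon_def lyndon_vertex_def)

lemma bicolored_lyndon_simps [simp]:
  "bicolored_lyndon (Leaf i)"
  "bicolored_lyndon (Node c L R) \<longleftrightarrow> nu L \<le> nu R \<and> bicolored_lyndon L \<and> bicolored_lyndon R \<and>
     (internal L \<longrightarrow> nu R < nu (right L) \<or> c < color L)"
  by (auto simp: bicolored_lyndon_def lyndon_vertex_def)

lemma set_leaves_graft: "set (leaves (graft u S T j)) = set (leaves S) \<union> set (leaves T)"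
  by (induction u S T j rule: graft.induct) auto

lemma graft_0 [simp]: "graft u S T 0 = Node u S T"
  by (cases S) auto

lemma graft_neq_Leaf [simp]: "graft u S T j \<noteq> Leaf i"
  by (induction u S T j rule: graft.induct) auto

text \<open>Undoes a merge: the new vertex is either the root of the result or sits in its left
  branch, and then the root and its right subtree come from \<open>S\<close>. This finds all lower
  covers of a given tree.\<close>

lemma graft_eq_Node:
  "graft u S T j = Node c L R \<Longrightarrow> u = c \<and> S = L \<and> T = R \<and> (j = 0 \<or> \<not> internal S) \<or>
     (\<exists>j' S'. j = Suc j' \<and> S = Node c S' R \<and> graft u S' T j' = L)"
  by (cases j; cases S) auto

lemma is_merge_Leaf: "is_merge ok u (Leaf i) T M \<longleftrightarrow> M = Node u (Leaf i) T \<and> ok M"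
  by (auto simp: is_merge_def)

text \<open>The left depth is one, so at most one replacement can happen and it is governed by a
  single test.\<close>

lemma is_merge_cherry:
  "is_merge ok u (Node c (Leaf i) R) T M \<longleftrightarrow>
     (if ok (Node u (Node c (Leaf i) R) T) then M = Node u (Node c (Leaf i) R) T
      else M = Node c (Node u (Leaf i) T) R \<and> ok M)"
proof -
  have *: "(\<exists>j\<le>Suc 0. Q j) \<longleftrightarrow> Q 0 \<or> Q (Suc 0)" for Q
    by (auto simp: le_Suc_eq)
  show ?thesis by (auto simp: is_merge_def *)
qed

section \<open>Forest posets near the minimum, for both types of trees\<close>

locale merge_poset =
  fixes ok :: "btree \<Rightarrow> bool" and n :: nat
  assumes ok_Leaf: "ok (Leaf i)"
    and ok_Node: "ok (Node c L R) \<Longrightarrow> ok L \<and> ok R \<and> nu L \<le> nu R"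
    and ok_cherry: "i < j \<Longrightarrow> ok (Node u (Leaf i) (Leaf j))"
begin

abbreviation "Fs \<equiv> forests ok n"

lemma forest_disjoint: "F \<in> Fs \<Longrightarrow> S \<in> F \<Longrightarrow> T \<in> F \<Longrightarrow> S \<noteq> T \<Longrightarrow> set (leaves S) \<inter> set (leaves T) = {}"
  by (simp add: forests_def)

lemma forest_inj_nu: "F \<in> Fs \<Longrightarrow> inj_on nu F"
  using forest_disjoint nu_in_leaves by (intro inj_onI) (metis disjoint_iff)

lemma forest_nu: "F \<in> Fs \<Longrightarrow> nu ` F \<subseteq> {1..n}"
proof
  fix i assume F: "F \<in> Fs" and "i \<in> nu ` F"
  then obtain T where T: "T \<in> F" "i = nu T" by blast
  have "(\<Union>T\<in>F. set (leaves T)) = {1..n}" using F by (simp add: forests_def)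
  then show "i \<in> {1..n}" using T nu_in_leaves by blast
qed

lemma finite_forest: "F \<in> Fs \<Longrightarrow> finite F"
  using forest_inj_nu forest_nu by (meson finite_atLeastAtMost inj_on_finite)

lemma card_forest: "F \<in> Fs \<Longrightarrow> card F \<le> n"
  using card_inj_on_le[OF forest_inj_nu forest_nu] by simp

lemma merge_coverE:
  assumes "F \<in> Fs" "merge_cover ok F F'"
  obtains S T u M where "S \<in> F" "T \<in> F" "nu S < nu T" "is_merge ok u S T M"
    "F' = insert M (F - {S, T})" "M \<notin> F - {S, T}" "F = insert S (insert T (F' - {M}))"
proof -
  obtain S T u M where *: "S \<in> F" "T \<in> F" "nu S < nu T" "is_merge ok u S T M" "F' = insert M (F - {S, T})"
    using assms(2) unfolding merge_cover_def by blast
  have "set (leaves M) = set (leaves S) \<union> set (leaves T)"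
    using *(4) by (auto simp: is_merge_def set_leaves_graft)
  then have lf: "nu S \<in> set (leaves M)" using nu_in_leaves by blast
  have M: "M \<notin> F - {S, T}"
  proof
    assume "M \<in> F - {S, T}"
    then have "set (leaves M) \<inter> set (leaves S) = {}" using forest_disjoint[OF assms(1), of M S] *(1) by blast
    then show False using lf nu_in_leaves by blast
  qed
  then have "F = insert S (insert T (F' - {M}))" using *(1,2,5) by blast
  then show thesis using that * M by blast
qed

sublocale ranked_steps Fs "merge_cover ok" "\<lambda>F. n - card F"
proof
  fix F F' assume F: "F \<in> Fs" "F' \<in> Fs" "merge_cover ok F F'"
  obtain S T u M where m: "S \<in> F" "T \<in> F" "nu S < nu T" "is_merge ok u S T M"
    "F' = insert M (F - {S, T})" "M \<notin> F - {S, T}" "F = insert S (insert T (F' - {M}))"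
    using F(1,3) by (rule merge_coverE)
  have fin: "finite F" by (rule finite_forest[OF F(1)])
  have "S \<noteq> T" using m(3) by auto
  then have "card F = Suc (Suc (card (F - {S, T})))"
    using fin m(1,2) by (metis Diff_insert2 card.remove finite_Diff insertE insert_Diff)
  moreover have "card F' = Suc (card (F - {S, T}))" using m(5,6) fin by simp
  ultimately show "n - card F' = Suc (n - card F)" using card_forest[OF F(1)] by auto
qed

definition singletons :: "btree set" where
  "singletons = Leaf ` {1..n}"

text \<open>For an internal \<open>T\<close> this forest has \<open>T\<close> as its only tree that
  is not a leaf. The atoms are of this form, with a cherry for \<open>T\<close>.\<close>

definition with_tree :: "btree \<Rightarrow> btree set" where
  "with_tree T = insert T (Leaf ` ({1..n} - set (leaves T)))"

lemma singletons_forest: "singletons \<in> Fs"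
  by (auto simp: forests_def singletons_def ok_Leaf)

lemma with_tree_forest:
  assumes "ok T" "distinct (leaves T)" "set (leaves T) \<subseteq> {1..n}"
  shows "with_tree T \<in> Fs"
  using assms by (auto simp: forests_def with_tree_def ok_Leaf)

lemma with_tree_inj: "internal S \<Longrightarrow> internal T \<Longrightarrow> with_tree S = with_tree T \<Longrightarrow> S = T"
  by (auto simp: with_tree_def)

lemma singletons_minimal: "F \<in> Fs \<Longrightarrow> \<not> merge_cover ok F singletons"
proof
  assume "F \<in> Fs" "merge_cover ok F singletons"
  then obtain S T u M where "is_merge ok u S T M" "singletons = insert M (F - {S, T})"
    by (rule merge_coverE)
  then have "M \<in> singletons" "\<And>i. M \<noteq> Leaf i" by (auto simp: is_merge_def)
  then show False by (auto simp: singletons_def)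
qed

text \<open>A tree with an internal root can be cut there: its two subtrees are again of the
  required type, and merging them with the color of the root needs no replacement.\<close>

lemma minimal_singletons:
  assumes F: "F \<in> Fs" and mn: "\<And>G. G \<in> Fs \<Longrightarrow> \<not> merge_cover ok G F"
  shows "F = singletons"
proof -
  have lf: "\<exists>i. T = Leaf i" if T: "T \<in> F" for T
  proof (cases T)
    case (Node c L R)
    have okT: "ok T" "distinct (leaves T)" using F T by (auto simp: forests_def)
    have LR: "ok L" "ok R" "nu L \<le> nu R" "distinct (leaves L)" "distinct (leaves R)"
      "set (leaves L) \<inter> set (leaves R) = {}"
      using okT ok_Node[of c L R] by (auto simp: Node)
    have ne: "nu L \<noteq> nu R" using LR(6) nu_in_leaves[of L] nu_in_leaves[of R] by auto
    have lT: "set (leaves T) = set (leaves L) \<union> set (leaves R)" by (simp add: Node)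
    have dj: "set (leaves S) \<inter> set (leaves L) = {}" "set (leaves S) \<inter> set (leaves R) = {}"
      if "S \<in> F - {T}" for S
      using forest_disjoint[OF F, of S T] that T lT by auto
    let ?G = "insert L (insert R (F - {T}))"
    have G1: "ok S \<and> distinct (leaves S)" if "S \<in> ?G" for S
      using that F LR by (auto simp: forests_def)
    have G2: "set (leaves S) \<inter> set (leaves S') = {}" if "S \<in> ?G" "S' \<in> ?G" "S \<noteq> S'" for S S'
    proof -
      have "S = L \<or> S = R \<or> S \<in> F - {T}" "S' = L \<or> S' = R \<or> S' \<in> F - {T}" using that by auto
      moreover have "S \<in> F - {T} \<Longrightarrow> S' \<in> F - {T} \<Longrightarrow> set (leaves S) \<inter> set (leaves S') = {}"
        using forest_disjoint[OF F, of S S'] that(3) by auto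
      ultimately show ?thesis using LR(6) that(3) dj[of S] dj[of S'] by (elim disjE) (simp_all add: Int_commute)
    qed
    have "(\<Union>S\<in>?G. set (leaves S)) = set (leaves T) \<union> (\<Union>S\<in>F - {T}. set (leaves S))"
      by (simp add: lT Un_assoc)
    also have "\<dots> = (\<Union>S\<in>F. set (leaves S))" using T by blast
    also have "\<dots> = {1..n}" using F by (simp add: forests_def)
    finally have "?G \<in> Fs" unfolding forests_def using G1 G2 by simp
    moreover have "merge_cover ok ?G F"
      unfolding merge_cover_def
    proof (intro bexI exI conjI)
      show "nu L < nu R" using LR(3) ne by simp
      show "is_merge ok c L R T" using okT(1) by (auto simp: is_merge_def Node intro!: exI[of _ 0])
      have "L \<notin> F - {T}" using dj(1)[of L] nu_in_leaves[of L] by auto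
      moreover have "R \<notin> F - {T}" using dj(2)[of R] nu_in_leaves[of R] by auto
      ultimately show "F = insert T (?G - {L, R})" using T by blast
    qed auto
    ultimately show ?thesis using mn by blast
  qed simp
  have un: "(\<Union>T\<in>F. set (leaves T)) = {1..n}" using F by (simp add: forests_def)
  show ?thesis
  proof
    show "F \<subseteq> singletons"
    proof
      fix T assume T: "T \<in> F"
      then obtain i where i: "T = Leaf i" using lf by blast
      have "set (leaves T) \<subseteq> {1..n}" unfolding un[symmetric] using T by (rule UN_upper)
      then show "T \<in> singletons" using i by (simp add: singletons_def)
    qed
    show "singletons \<subseteq> F"
    proof
      fix T assume "T \<in> singletons"
      then obtain i where i: "T = Leaf i" "i \<in> {1..n}" by (auto simp: singletons_def)
      then obtain S where "S \<in> F" "i \<in> set (leaves S)" using un by blast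
      then show "T \<in> F" using lf[of S] i by auto
    qed
  qed
qed

lemma cover_singletonsE:
  assumes "merge_cover ok singletons F"
  obtains u i j where "1 \<le> i" "i < j" "j \<le> n" "F = with_tree (Node u (Leaf i) (Leaf j))"
proof -
  obtain S T u M where m: "S \<in> singletons" "T \<in> singletons" "nu S < nu T" "is_merge ok u S T M"
    "F = insert M (singletons - {S, T})"
    using assms unfolding merge_cover_def by blast
  then obtain i j where ij: "S = Leaf i" "T = Leaf j" "1 \<le> i" "j \<le> n" "i < j" by (auto simp: singletons_def)
  then have "M = Node u (Leaf i) (Leaf j)" using m(4) by (simp add: is_merge_Leaf)
  then have "F = with_tree (Node u (Leaf i) (Leaf j))"
    using m(5) ij by (auto simp: with_tree_def singletons_def)
  then show thesis using that ij by blast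
qed

lemma singletons_cover:
  assumes "1 \<le> i" "i < j" "j \<le> n"
  shows "merge_cover ok singletons (with_tree (Node u (Leaf i) (Leaf j)))"
  unfolding merge_cover_def
proof (intro bexI exI conjI)
  show "nu (Leaf i) < nu (Leaf j)" using assms by simp
  show "is_merge ok u (Leaf i) (Leaf j) (Node u (Leaf i) (Leaf j))"
    using ok_cherry assms by (simp add: is_merge_Leaf)
  show "with_tree (Node u (Leaf i) (Leaf j)) = insert (Node u (Leaf i) (Leaf j)) (singletons - {Leaf i, Leaf j})"
    by (auto simp: with_tree_def singletons_def)
qed (use assms in \<open>auto simp: singletons_def\<close>)

lemma merge_with_tree_Leaf:
  assumes "k \<notin> set (leaves K)" "internal K" "set (leaves M) = insert k (set (leaves K))"
  shows "insert M (with_tree K - {K, Leaf k}) = with_tree M"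
    and "insert M (with_tree K - {Leaf k, K}) = with_tree M"
proof -
  have "K \<noteq> Leaf l" for l using assms(2) by auto
  then show "insert M (with_tree K - {K, Leaf k}) = with_tree M"
    using assms by (auto simp: with_tree_def)
  then show "insert M (with_tree K - {Leaf k, K}) = with_tree M" by (simp add: insert_commute)
qed

lemma with_tree_cover_right:
  assumes "is_merge ok u K (Leaf k) M" "internal K" "nu K < k" "k \<le> n" "k \<notin> set (leaves K)"
  shows "merge_cover ok (with_tree K) (with_tree M)"
  unfolding merge_cover_def
proof (intro bexI exI conjI)
  show "nu K < nu (Leaf k)" using assms by simp
  show "is_merge ok u K (Leaf k) M" by fact
  have "set (leaves M) = insert k (set (leaves K))"
    using assms(1) by (auto simp: is_merge_def set_leaves_graft)
  then show "with_tree M = insert M (with_tree K - {K, Leaf k})"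
    using merge_with_tree_Leaf assms by simp
qed (use assms in \<open>auto simp: with_tree_def\<close>)

lemma with_tree_cover_left:
  assumes "is_merge ok u (Leaf k) K M" "internal K" "k < nu K" "1 \<le> k" "k \<le> n" "k \<notin> set (leaves K)"
  shows "merge_cover ok (with_tree K) (with_tree M)"
  unfolding merge_cover_def
proof (intro bexI exI conjI)
  show "nu (Leaf k) < nu K" using assms by simp
  show "is_merge ok u (Leaf k) K M" by fact
  have "set (leaves M) = insert k (set (leaves K))"
    using assms(1) by (auto simp: is_merge_def set_leaves_graft)
  then show "with_tree M = insert M (with_tree K - {Leaf k, K})"
    using merge_with_tree_Leaf assms by simp
qed (use assms in \<open>auto simp: with_tree_def\<close>)

lemma cover_with_treeE:
  assumes "G \<in> Fs" "merge_cover ok G (with_tree M)" "internal M"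
  obtains S T u where "is_merge ok u S T M" "G = insert S (insert T (with_tree M - {M}))"
proof -
  obtain S T u M' where m: "S \<in> G" "T \<in> G" "nu S < nu T" "is_merge ok u S T M'"
    "with_tree M = insert M' (G - {S, T})" "M' \<notin> G - {S, T}" "G = insert S (insert T (with_tree M - {M'}))"
    using assms(1,2) by (rule merge_coverE)
  have "M' \<in> with_tree M" using m(5) by blast
  moreover have "M' \<noteq> Leaf i" for i using m(4) by (auto simp: is_merge_def)
  ultimately have "M' = M" by (auto simp: with_tree_def)
  then show thesis using that m by blast
qed

text \<open>Merges of disjoint pairs commute, so such an element also covers the second
  atom.\<close>

lemma cover_two_cherries:
  assumes "1 \<le> i" "i < j" "j \<le> n" "1 \<le> k" "k < l" "l \<le> n" "{k, l} \<inter> {i, j} = {}"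
    and y: "y = insert (Node v (Leaf k) (Leaf l)) (with_tree (Node u (Leaf i) (Leaf j)) - {Leaf k, Leaf l})"
  shows "\<exists>b\<in>Fs. merge_cover ok b y \<and> b \<noteq> with_tree (Node u (Leaf i) (Leaf j))"
proof (intro bexI conjI)
  let ?b = "with_tree (Node v (Leaf k) (Leaf l))"
  show "?b \<in> Fs" using assms ok_cherry by (intro with_tree_forest) auto
  show "?b \<noteq> with_tree (Node u (Leaf i) (Leaf j))" 
    using assms(7) with_tree_inj[of "Node v (Leaf k) (Leaf l)" "Node u (Leaf i) (Leaf j)"] by auto
  show "merge_cover ok ?b y"
    unfolding merge_cover_def
  proof (intro bexI exI conjI)
    show "nu (Leaf i) < nu (Leaf j)" using assms by simp
    show "is_merge ok u (Leaf i) (Leaf j) (Node u (Leaf i) (Leaf j))"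
      using ok_cherry assms by (simp add: is_merge_Leaf)
    show "y = insert (Node u (Leaf i) (Leaf j)) (?b - {Leaf i, Leaf j})"
      using assms by (auto simp: with_tree_def)
  qed (use assms in \<open>auto simp: with_tree_def\<close>)
qed

text \<open>Sorts the covers of an atom by the two trees merged. The case \<open>left\<close> keeps
  nothing but \<open>k < i\<close>: it is there to be refuted when \<open>i = 1\<close>.\<close>

lemma cover_atom_cases:
  assumes ij: "1 \<le> i" "i < j" "j \<le> n"
    and "merge_cover ok (with_tree (Node u (Leaf i) (Leaf j))) y"
  obtains (two) b where "b \<in> Fs" "merge_cover ok b y" "b \<noteq> with_tree (Node u (Leaf i) (Leaf j))"
    | (right) v k M where "i < k" "k \<le> n" "k \<noteq> j" "is_merge ok v (Node u (Leaf i) (Leaf j)) (Leaf k) M" "y = with_tree M"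
    | (left) k where "1 \<le> k" "k < i"
proof -
  let ?K = "Node u (Leaf i) (Leaf j)"
  obtain S T v M where m: "S \<in> with_tree ?K" "T \<in> with_tree ?K" "nu S < nu T" "is_merge ok v S T M"
    "y = insert M (with_tree ?K - {S, T})"
    using assms(4) unfolding merge_cover_def by blast
  have "S = ?K \<or> (\<exists>k\<in>{1..n} - {i, j}. S = Leaf k)" "T = ?K \<or> (\<exists>k\<in>{1..n} - {i, j}. T = Leaf k)"
    using m(1,2) by (auto simp: with_tree_def)
  then consider "S = ?K" "T = ?K" | k where "S = ?K" "T = Leaf k" "k \<in> {1..n} - {i, j}"
    | k where "S = Leaf k" "T = ?K" "k \<in> {1..n} - {i, j}"
    | k l where "S = Leaf k" "T = Leaf l" "k \<in> {1..n} - {i, j}" "l \<in> {1..n} - {i, j}"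
    by blast
  then show thesis
  proof cases
    case 1
    then show thesis using m(3) by simp
  next
    case 2
    have "set (leaves M) = insert k (set (leaves ?K))"
      using m(4) 2 by (auto simp: is_merge_def set_leaves_graft)
    then have "y = with_tree M" using merge_with_tree_Leaf[of k ?K M] m(5) 2 by simp
    then show thesis using right[of k v M] m 2 ij by auto
  next
    case 3
    then show thesis using left[of k] m(3) ij by auto
  next
    case 4
    then have "M = Node v (Leaf k) (Leaf l)" using m(4) by (simp add: is_merge_Leaf)
    then show thesis
      using cover_two_cherries[of i j k l y v u] ij 4 m(3,5) two by auto
  qed
qed

text \<open>\<open>singletons\<close> is the only forest that covers nothing, and the forests
  covering it are those with one cherry.\<close>

lemma lonely_iff:
  "has_lonely_cover ord \<longleftrightarrow> (\<exists>u i j. 1 \<le> i \<and> i < j \<and> j \<le> n \<and> (\<exists>!y. y \<in> Fs \<and>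
     merge_cover ok (with_tree (Node u (Leaf i) (Leaf j))) y \<and>
     (\<forall>b\<in>Fs. merge_cover ok b y \<longrightarrow> b = with_tree (Node u (Leaf i) (Leaf j)))))"
    (is "_ \<longleftrightarrow> (\<exists>u i j. 1 \<le> i \<and> i < j \<and> j \<le> n \<and> (\<exists>!y. ?Q u i j y))")
proof -
  have aF: "with_tree (Node u (Leaf i) (Leaf j)) \<in> Fs" if "1 \<le> i" "i < j" "j \<le> n" for u i j
    using that ok_cherry by (intro with_tree_forest) auto
  have mn: "z \<in> Field ord \<and> (\<forall>w. \<not> covers ord w z) \<longleftrightarrow> z = singletons" for z
    unfolding covers_iff_step Field_ord
    using minimal_singletons singletons_forest singletons_minimal by blast
  have at: "covers ord singletons a \<longleftrightarrow>
      (\<exists>u i j. 1 \<le> i \<and> i < j \<and> j \<le> n \<and> a = with_tree (Node u (Leaf i) (Leaf j)))" for a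
  proof
    assume "covers ord singletons a"
    then have "merge_cover ok singletons a" by (simp add: covers_iff_step)
    then show "\<exists>u i j. 1 \<le> i \<and> i < j \<and> j \<le> n \<and> a = with_tree (Node u (Leaf i) (Leaf j))"
      by (rule cover_singletonsE) blast
  next
    assume "\<exists>u i j. 1 \<le> i \<and> i < j \<and> j \<le> n \<and> a = with_tree (Node u (Leaf i) (Leaf j))"
    then show "covers ord singletons a"
      unfolding covers_iff_step using singletons_forest singletons_cover aF by blast
  qed
  have Q: "covers ord a y \<and> (\<forall>b. covers ord b y \<longrightarrow> b = a) \<longleftrightarrow> 
     y \<in> Fs \<and> merge_cover ok a y \<and> (\<forall>b\<in>Fs. merge_cover ok b y \<longrightarrow> b = a)" if "a \<in> Fs" for a y
    unfolding covers_iff_step using that by auto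
  define L where "L a \<longleftrightarrow> (\<exists>!y. covers ord a y \<and> (\<forall>b. covers ord b y \<longrightarrow> b = a))" for a
  have L: "L (with_tree (Node u (Leaf i) (Leaf j))) \<longleftrightarrow> (\<exists>!y. ?Q u i j y)"
    if "1 \<le> i" "i < j" "j \<le> n" for u i j
    unfolding L_def Q[OF aF[OF that]] ..
  have "has_lonely_cover ord \<longleftrightarrow>
      (\<exists>z. (z \<in> Field ord \<and> (\<forall>w. \<not> covers ord w z)) \<and> (\<exists>a. covers ord z a \<and> L a))"
    unfolding has_lonely_cover_def L_def[symmetric] by blast
  also have "\<dots> \<longleftrightarrow> (\<exists>a. covers ord singletons a \<and> L a)" unfolding mn by simp
  also have "\<dots> \<longleftrightarrow> (\<exists>u i j. 1 \<le> i \<and> i < j \<and> j \<le> n \<and> L (with_tree (Node u (Leaf i) (Leaf j))))"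
    unfolding at by blast
  also have "\<dots> \<longleftrightarrow> (\<exists>u i j. 1 \<le> i \<and> i < j \<and> j \<le> n \<and> (\<exists>!y. ?Q u i j y))"
    using L by (simp cong: conj_cong)
  finally show ?thesis .
qed

end

section \<open>Lonely covers in the two forest posets\<close>

lemma merge_poset_pointed: "merge_poset pointed_lyndon"
  and merge_poset_bicolored: "merge_poset bicolored_lyndon"
  by unfold_locales auto

text \<open>With \<open>j = 3\<close>, the leaf 2 can be placed above the cherry by the Lyndon
  condition alone, even under a root of color 1. For this \<open>k\<close> and this color, the two
  orders of insertion lead to different trees.\<close>

lemma FLyn_weighted_lonely:
  assumes "3 \<le> n"
  shows "has_lonely_cover (FLyn_weighted n)"
proof -
  interpret merge_poset bicolored_lyndon n by (rule merge_poset_bicolored)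
  let ?K = "Node False (Leaf 1) (Leaf 3)"
  let ?M = "Node True ?K (Leaf 2)"
  let ?Q = "\<lambda>y. y \<in> Fs \<and> merge_cover bicolored_lyndon (with_tree ?K) y \<and>
    (\<forall>b\<in>Fs. merge_cover bicolored_lyndon b y \<longrightarrow> b = with_tree ?K)"
  have "\<exists>!y. ?Q y"
  proof (rule ex1I)
    show "?Q (with_tree ?M)"
    proof (intro conjI ballI impI)
      show "with_tree ?M \<in> Fs" using assms by (intro with_tree_forest) auto
      have "is_merge bicolored_lyndon True ?K (Leaf 2) ?M" by (simp add: is_merge_cherry)
      then show "merge_cover bicolored_lyndon (with_tree ?K) (with_tree ?M)"
        by (rule with_tree_cover_right) (use assms in auto)
      fix b assume b: "b \<in> Fs" "merge_cover bicolored_lyndon b (with_tree ?M)"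
      then obtain S T u where m: "is_merge bicolored_lyndon u S T ?M"
        "b = insert S (insert T (with_tree ?M - {?M}))"
        by (rule cover_with_treeE) simp
      obtain l where l: "graft u S T l = ?M" "\<forall>i<l. \<not> bicolored_lyndon (graft u S T i)"
        using m(1) by (auto simp: is_merge_def)
      from graft_eq_Node[OF l(1)] have "S = ?K \<and> T = Leaf 2"
      proof (elim disjE exE conjE)
        \<comment> \<open>The other candidate adds 3 with color 0 to the cherry of 1 and 2 of color
          1. There the left child has the larger color, so the merge stops at the root and does not
          yield \<open>?M\<close>.\<close>
        fix j' S' assume j': "l = Suc j'" "S = Node True S' (Leaf 2)" "graft u S' T j' = ?K"
        from graft_eq_Node[OF j'(3)] have "u = False \<and> S' = Leaf 1 \<and> T = Leaf 3" by auto
        then show ?thesis using l(2) j' by auto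
      qed auto
      then show "b = with_tree ?K" using m(2) assms by (auto simp: with_tree_def)
    qed
  next
    fix y assume y: "?Q y"
    then have "merge_cover bicolored_lyndon (with_tree ?K) y" by blast
    then show "y = with_tree ?M"
    proof (rule cover_atom_cases[rotated 3])
      fix b assume "b \<in> Fs" "merge_cover bicolored_lyndon b y" "b \<noteq> with_tree ?K"
      then show ?thesis using y by blast
    next
      fix v k M assume k: "1 < k" "k \<le> n" "k \<noteq> 3"
        and M: "is_merge bicolored_lyndon v ?K (Leaf k) M" and yM: "y = with_tree M"
      let ?b = "with_tree (Node v (Leaf 1) (Leaf k))"
      \<comment> \<open>For all other choices, the same tree results from adding 3 with color 0 to
        the cherry of 1 and \<open>k\<close> of color \<open>v\<close>, which is a second lower
        cover.\<close>
      have False if "v = False \<or> k \<noteq> 2"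
      proof -
        have "is_merge bicolored_lyndon False (Node v (Leaf 1) (Leaf k)) (Leaf 3) M"
          using M that k by (auto simp: is_merge_cherry split: if_splits)
        then have "merge_cover bicolored_lyndon ?b y"
          unfolding yM by (rule with_tree_cover_right) (use assms k in auto)
        moreover have "?b \<in> Fs" using k by (intro with_tree_forest) auto
        ultimately have "?b = with_tree ?K" using y by blast
        then show False using with_tree_inj[of "Node v (Leaf 1) (Leaf k)" ?K] k by simp
      qed
      then have "v" "k = 2" by auto
      then show ?thesis using M yM by (simp add: is_merge_cherry)
    qed (use assms in auto)
  qed
  then have "has_lonely_cover ord"
    unfolding lonely_iff using assms by (intro exI[of _ False] exI[of _ 1] exI[of _ 3]) simp
  then show ?thesis by (simp add: FLyn_weighted_def)
qed

lemma FLyn_pointed_not_lonely: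
  assumes "4 \<le> n"
  shows "\<not> has_lonely_cover (FLyn_pointed n)"
proof
  interpret merge_poset pointed_lyndon n by (rule merge_poset_pointed)
  assume "has_lonely_cover (FLyn_pointed n)"
  then have "has_lonely_cover ord" by (simp add: FLyn_pointed_def)
  then obtain u i j where ij: "1 \<le> i" "i < j" "j \<le> n" and
    ex1: "\<exists>!y. y \<in> Fs \<and> merge_cover pointed_lyndon (with_tree (Node u (Leaf i) (Leaf j))) y \<and>
     (\<forall>b\<in>Fs. merge_cover pointed_lyndon b y \<longrightarrow> b = with_tree (Node u (Leaf i) (Leaf j)))"
    unfolding lonely_iff by (elim exE conjE) (rule that)
  let ?K = "Node u (Leaf i) (Leaf j)"
  let ?Q = "\<lambda>y. y \<in> Fs \<and> merge_cover pointed_lyndon (with_tree ?K) y \<and>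
    (\<forall>b\<in>Fs. merge_cover pointed_lyndon b y \<longrightarrow> b = with_tree ?K)"
  consider "1 < i" | "i = 1" "\<not> u" | "i = 1" "u" using ij by linarith
  then show False
  proof cases
    case 1
    \<comment> \<open>The left child of the root is a leaf, so the root must be the new vertex and
      the lower cover is unique. The two colors \<open>v\<close> already give two such
      elements.\<close>
    have "?Q (with_tree (Node v (Leaf 1) ?K))" for v
    proof (intro conjI ballI impI)
      let ?M = "Node v (Leaf 1) ?K"
      show "with_tree ?M \<in> Fs" using 1 ij by (intro with_tree_forest) auto
      have "is_merge pointed_lyndon v (Leaf 1) ?K ?M" using 1 ij by (simp add: is_merge_Leaf)
      then show "merge_cover pointed_lyndon (with_tree ?K) (with_tree ?M)"
        by (rule with_tree_cover_left) (use ij 1 in auto)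
      fix b assume b: "b \<in> Fs" "merge_cover pointed_lyndon b (with_tree ?M)"
      then obtain S T w where m: "is_merge pointed_lyndon w S T ?M"
        "b = insert S (insert T (with_tree ?M - {?M}))"
        by (rule cover_with_treeE) simp
      obtain l where l: "graft w S T l = ?M" using m(1) by (auto simp: is_merge_def)
      from graft_eq_Node[OF l] have "S = Leaf 1 \<and> T = ?K" by auto
      then show "b = with_tree ?K" using m(2) ij 1 by (auto simp: with_tree_def)
    qed
    then have "with_tree (Node True (Leaf 1) ?K) = with_tree (Node False (Leaf 1) ?K)" using ex1 by blast
    then show False using with_tree_inj[of "Node True (Leaf 1) ?K" "Node False (Leaf 1) ?K"] by simp
  next
    case 2
    \<comment> \<open>Two adjacent vertices of color 0 are subject to no Lyndon condition, so the
      right leaves can occur in any order.\<close>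
    have Qk: "?Q (with_tree (Node False ?K (Leaf k)))" if k: "1 < k" "k \<le> n" "k \<noteq> j" for k
    proof (intro conjI ballI impI)
      let ?M = "Node False ?K (Leaf k)"
      show "with_tree ?M \<in> Fs" using 2 ij k by (intro with_tree_forest) auto
      have "is_merge pointed_lyndon False ?K (Leaf k) ?M" using 2 ij k by (simp add: is_merge_cherry)
      then show "merge_cover pointed_lyndon (with_tree ?K) (with_tree ?M)"
        by (rule with_tree_cover_right) (use ij 2 k in auto)
      fix b assume b: "b \<in> Fs" "merge_cover pointed_lyndon b (with_tree ?M)"
      then obtain S T w where m: "is_merge pointed_lyndon w S T ?M"
        "b = insert S (insert T (with_tree ?M - {?M}))"
        by (rule cover_with_treeE) simp
      obtain l where l: "graft w S T l = ?M" "\<forall>i<l. \<not> pointed_lyndon (graft w S T i)"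
        using m(1) by (auto simp: is_merge_def)
      from graft_eq_Node[OF l(1)] have "S = ?K \<and> T = Leaf k"
      proof (elim disjE exE conjE)
        fix j' S' assume j': "l = Suc j'" "S = Node False S' (Leaf k)" "graft w S' T j' = ?K"
        \<comment> \<open>Adding \<open>j\<close> to the cherry of 1 and \<open>k\<close>, both with
          color 0, is admissible at the root, so no replacement could have produced
          \<open>?M\<close> from it.\<close>
        from graft_eq_Node[OF j'(3)] have "w = False \<and> S' = Leaf 1 \<and> T = Leaf j" using 2 by auto
        then have "pointed_lyndon (graft w S T 0)" using j'(2) k ij 2 by simp
        then show ?thesis using l(2) j'(1) by blast
      qed auto
      then show "b = with_tree ?K" using m(2) ij k 2 by (auto simp: with_tree_def)
    qed
    \<comment> \<open>This is where \<open>4 <= n\<close> matters: besides \<open>j\<close>, at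
      least two of the labels 2, 3, 4 remain.\<close>
    obtain k k' where k: "1 < k" "k < k'" "k' \<le> n" "k \<noteq> j" "k' \<noteq> j"
    proof -
      consider "j = 2" | "j = 3" | "3 < j" using ij by linarith
      then show thesis
      proof cases
        case 1
        then show thesis using that[of 3 4] assms by simp
      next
        case 2
        then show thesis using that[of 2 4] assms by simp
      next
        case 3
        then show thesis using that[of 2 3] ij by simp
      qed
    qed
    have "?Q (with_tree (Node False ?K (Leaf k)))" "?Q (with_tree (Node False ?K (Leaf k')))"
      using Qk[of k] Qk[of k'] k by auto
    then have "with_tree (Node False ?K (Leaf k)) = with_tree (Node False ?K (Leaf k'))" using ex1 by blast
    then show False using with_tree_inj[of "Node False ?K (Leaf k)" "Node False ?K (Leaf k')"] k by simp
  next
    case 3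
    obtain y where y: "?Q y" using ex1 by blast
    then have "merge_cover pointed_lyndon (with_tree ?K) y" by blast
    then show False
    proof (rule cover_atom_cases[OF ij])
      fix b assume "b \<in> Fs" "merge_cover pointed_lyndon b y" "b \<noteq> with_tree ?K"
      then show ?thesis using y by blast
    next
      fix v k M assume k: "i < k" "k \<le> n" "k \<noteq> j"
        and M: "is_merge pointed_lyndon v ?K (Leaf k) M" and yM: "y = with_tree M"
      let ?b = "with_tree (Node v (Leaf 1) (Leaf k))"
      \<comment> \<open>Both orders of insertion agree: for \<open>v\<close> true, replacement puts
        the larger of \<open>j\<close> and \<open>k\<close> lower; for \<open>v\<close> false, the
        vertex of color 1 must end below the one of color 0. So there is a second lower
        cover.\<close>
      have "is_merge pointed_lyndon True (Node v (Leaf 1) (Leaf k)) (Leaf j) M"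
        using M k ij 3 by (cases v) (auto simp: is_merge_cherry split: if_splits)
      then have "merge_cover pointed_lyndon ?b y"
        unfolding yM by (rule with_tree_cover_right) (use 3 ij k in auto)
      moreover have "?b \<in> Fs" using k 3 by (intro with_tree_forest) auto
      ultimately have "?b = with_tree ?K" using y by blast
      then show False using with_tree_inj[of "Node v (Leaf 1) (Leaf k)" ?K] k by simp
    qed (use 3 in auto)
  qed
qed

theorem theorem5p4:
  fixes n :: nat
  assumes "n \<ge> 4"
  shows "\<not> poset_isomorphic (FLyn_weighted n) (FLyn_pointed n) \<and>
    (\<exists>(P :: btree set rel) (Q :: btree set rel).
       whitney_duals P (weighted_partition_poset n) \<and>
       whitney_duals Q (weighted_partition_poset n) \<and> \<not> poset_isomorphic P Q) \<and>
    (\<exists>(P :: btree set rel) (Q :: btree set rel).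
       whitney_duals P (pointed_partition_poset n) \<and>
       whitney_duals Q (pointed_partition_poset n) \<and> \<not> poset_isomorphic P Q)"
proof (intro conjI)
  have n: "0 < n" using assms by simp
  show "\<not> poset_isomorphic (FLyn_weighted n) (FLyn_pointed n)"
    using FLyn_weighted_lonely[of n] FLyn_pointed_not_lonely[of n] poset_isomorphic_lonely_cover assms by auto
  show "\<exists>(P :: btree set rel) (Q :: btree set rel).
       whitney_duals P (weighted_partition_poset n) \<and>
       whitney_duals Q (weighted_partition_poset n) \<and> \<not> poset_isomorphic P Q"
    using weighted_partition_poset_numbers[OF n] by (intro two_Whitney_duals[OF assms])
  show "\<exists>(P :: btree set rel) (Q :: btree set rel).
       whitney_duals P (pointed_partition_poset n) \<and>
       whitney_duals Q (pointed_partition_poset n) \<and> \<not> poset_isomorphic P Q"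
    using pointed_partition_poset_numbers[OF n] by (intro two_Whitney_duals[OF assms])
qed

end
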